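(* Assume the setting in the context, including $\int_\Omega|\log p(\omega,e)|^{d+\alpha}\,d\mathbb{P}<\infty$ for some $\alpha>0$ and all $e\in U$. Let $\lambda\in\mathbb{R}^d$. Then for each $\varepsilon>0$ there exists a function $F_\varepsilon\in\mathcal{K}$ such that $$\operatorname*{ess\,sup}_{\omega}\log\sum_{e\in U}p(\omega,e)\,\mathrm{e}^{\langle\lambda,e\rangle+F_\varepsilon(\omega,e)}\le\Gamma(\lambda)+\varepsilon.$$
   Context: Let $d\ge 1$ and $U=\{e\in\mathbb{Z}^d: |e|=1\}$. Let $(\Omega,\mathcal{F},\mathbb{P})$ be a probability space with $\mathcal{F}$ countably generated, and let $\{T_e\}_{e\in U}$ be commuting $\mathbb{P}$-measure-preserving transformations with $T_{-e}=T_e^{-1}$, forming an ergodic family (every event invariant under all $T_e$ has probability $0$ or $1$); $T_x=T_{e_1}^{x_1}\cdots T_{e_d}^{x_d}$. Let $p:\Omega\times U\to[0,1]$ be measurable with $\sum_{e}p(\omega,e)=1$. A function $F:\Omega\times U\to\mathbb{R}$ is in class $\mathcal{K}$ if: (i) there is $\alpha>0$ with $\mathbb{E}[|F(\cdot,e)|^{d+\alpha}]<\infty$ for every $e$; (ii) $\mathbb{E}[F(\cdot,e)]=0$ for every $e$; (iii) ($\mathbb{P}$-a.s.) for every finite sequence $x_0,\dots,x_n\in\mathbb{Z}^d$ with $x_{i+1}-x_i\in U$ and $x_0=x_n$, $\sum_{i=0}^{n-1}F(T_{x_i}\omega,x_{i+1}-x_i)=0$. $$\Gamma(\lambda)=\sup_{(q,\phi)}\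 \inf_h\ \int_\Omega\sum_{e\in U}\left(\langle\lambda,e\rangle-\log\frac{q(\omega,e)}{p(\omega,e)}+h(\omega)-h(T_e\omega)\right)q(\omega,e)\,\phi(\omega)\,d\mathbb{P},$$ the supremum over measurable transition functions $q:\Omega\times U\to[0,1]$ with $\sum_e q(\omega,e)=1$ and probability densities $\phi$ with respect to $\mathbb{P}$, the infimum over bounded measurable $h$. Essential suprema are with respect to $\mathbb{P}$. *)

theory Defs
  imports "HOL-Analysis.Analysis" "HOL-Probability.Probability"
begin

definition unitvecs :: "(int ^ 'n::finite) set" where
  "unitvecs = {e. (\<Sum>i\<in>UNIV. (e $ i)^2) = 1}"

definition ip :: "real ^ 'n::finite \<Rightarrow> int ^ 'n \<Rightarrow> real" where
  "ip l e = (\<Sum>i\<in>UNIV. l $ i * real_of_int (e $ i))"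

definition countably_generated :: "'a measure \<Rightarrow> bool" where
  "countably_generated M \<longleftrightarrow> (\<exists>G. countable G \<and> G \<subseteq> Pow (space M) \<and> sets M = sigma_sets (space M) G)"

definition measure_preserving_map :: "'a measure \<Rightarrow> ('a \<Rightarrow> 'a) \<Rightarrow> bool" where
  "measure_preserving_map M S \<longleftrightarrow> S \<in> M \<rightarrow>\<^sub>M M \<and>
     (\<forall>A\<in>sets M. emeasure M (S -` A \<inter> space M) = emeasure M A)"

text \<open>The Z^d-action x \<mapsto> T_x generated by commuting measure-preserving maps T_e (e in U)
  with T_{-e} = T_e^{-1}, i.e. T_x = T_{e_1}^{x_1} ... T_{e_d}^{x_d}.\<close>
definition Zd_action :: "'a measure \<Rightarrow> (int ^ 'n::finite \<Rightarrow> 'a \<Rightarrow> 'a) \<Rightarrow> bool" where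
  "Zd_action M T \<longleftrightarrow>
     (\<forall>\<omega>\<in>space M. T 0 \<omega> = \<omega>) \<and>
     (\<forall>x y. \<forall>\<omega>\<in>space M. T (x + y) \<omega> = T x (T y \<omega>)) \<and>
     (\<forall>e\<in>unitvecs. measure_preserving_map M (T e))"

definition ergodic_family :: "'a measure \<Rightarrow> (int ^ 'n::finite \<Rightarrow> 'a \<Rightarrow> 'a) \<Rightarrow> bool" where
  "ergodic_family M T \<longleftrightarrow>
     (\<forall>A\<in>sets M. (\<forall>e\<in>unitvecs. T e -` A \<inter> space M = A) \<longrightarrow> prob_space.prob M A = 0 \<or> prob_space.prob M A = 1)"

definition transition_fn :: "'a measure \<Rightarrow> ('a \<Rightarrow> int ^ 'n::finite \<Rightarrow> real) \<Rightarrow> bool" where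
  "transition_fn M q \<longleftrightarrow>
     (\<forall>e\<in>unitvecs. (\<lambda>\<omega>. q \<omega> e) \<in> borel_measurable M) \<and>
     (\<forall>\<omega>\<in>space M. (\<forall>e\<in>unitvecs. 0 \<le> q \<omega> e \<and> q \<omega> e \<le> 1) \<and> (\<Sum>e\<in>unitvecs. q \<omega> e) = 1)"

definition prob_density :: "'a measure \<Rightarrow> ('a \<Rightarrow> real) \<Rightarrow> bool" where
  "prob_density M \<phi> \<longleftrightarrow> \<phi> \<in> borel_measurable M \<and> (\<forall>\<omega>\<in>space M. 0 \<le> \<phi> \<omega>) \<and>
     (\<integral>\<^sup>+\<omega>. ennreal (\<phi> \<omega>) \<partial>M) = 1"

definition bounded_measurable :: "'a measure \<Rightarrow> ('a \<Rightarrow> real) \<Rightarrow> bool" where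
  "bounded_measurable M h \<longleftrightarrow> h \<in> borel_measurable M \<and> (\<exists>B. \<forall>\<omega>\<in>space M. \<bar>h \<omega>\<bar> \<le> B)"

definition nn_path :: "(int ^ 'n::finite) list \<Rightarrow> bool" where
  "nn_path xs \<longleftrightarrow> xs \<noteq> [] \<and> (\<forall>i. Suc i < length xs \<longrightarrow> xs ! Suc i - xs ! i \<in> unitvecs)"

definition classK :: "'a measure \<Rightarrow> (int ^ 'n::finite \<Rightarrow> 'a \<Rightarrow> 'a) \<Rightarrow> ('a \<Rightarrow> int ^ 'n \<Rightarrow> real) \<Rightarrow> bool" where
  "classK M T F \<longleftrightarrow>
     (\<exists>\<alpha>>0. \<forall>e\<in>unitvecs. integrable M (\<lambda>\<omega>. \<bar>F \<omega> e\<bar> powr (real CARD('n) + \<alpha>))) \<and>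
     (\<forall>e\<in>unitvecs. integrable M (\<lambda>\<omega>. F \<omega> e) \<and> (\<integral>\<omega>. F \<omega> e \<partial>M) = 0) \<and>
     (AE \<omega> in M. \<forall>xs. nn_path xs \<and> hd xs = last xs \<longrightarrow>
        (\<Sum>i<length xs - 1. F (T (xs ! i) \<omega>) (xs ! Suc i - xs ! i)) = 0)"

text \<open>Extended-real Lebesgue integral \<integral> g^+ - \<integral> g^- (well defined whenever one part is finite).\<close>
definition ext_integral :: "'a measure \<Rightarrow> ('a \<Rightarrow> real) \<Rightarrow> ereal" where
  "ext_integral M g = enn2ereal (\<integral>\<^sup>+\<omega>. ennreal (g \<omega>) \<partial>M) - enn2ereal (\<integral>\<^sup>+\<omega>. ennreal (- g \<omega>) \<partial>M)"

definition Gamma_integrand ::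
  "(int ^ 'n::finite \<Rightarrow> 'a \<Rightarrow> 'a) \<Rightarrow> ('a \<Rightarrow> int ^ 'n \<Rightarrow> real) \<Rightarrow> real ^ 'n \<Rightarrow>
   ('a \<Rightarrow> int ^ 'n \<Rightarrow> real) \<Rightarrow> ('a \<Rightarrow> real) \<Rightarrow> ('a \<Rightarrow> real) \<Rightarrow> 'a \<Rightarrow> real" where
  "Gamma_integrand T p l q \<phi> h \<omega> =
     (\<Sum>e\<in>unitvecs. (ip l e + h \<omega> - h (T e \<omega>)) * q \<omega> e
        - (if q \<omega> e = 0 then 0 else q \<omega> e * ln (q \<omega> e / p \<omega> e))) * \<phi> \<omega>"

definition Gamma :: "'a measure \<Rightarrow> (int ^ 'n::finite \<Rightarrow> 'a \<Rightarrow> 'a) \<Rightarrow> ('a \<Rightarrow> int ^ 'n \<Rightarrow> real) \<Rightarrow> real ^ 'n \<Rightarrow> ereal" where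
  "Gamma M T p l =
     (SUP qphi \<in> {(q, \<phi>). transition_fn M q \<and> prob_density M \<phi>}.
        INF h \<in> {h. bounded_measurable M h}.
          ext_integral M (Gamma_integrand T p l (fst qphi) (snd qphi) h))"

end

theory Submission
  imports Defs
begin

text \<open>
  Write \<open>grad h \<omega> e = h \<omega> - h (T e \<omega>)\<close>, \<open>Phi x \<omega> = ln (\<Sum>e. p \<omega> e * exp (ip l e + x \<omega> e))\<close>,
  \<open>r = d + \<alpha>\<close> and \<open>c = \<Gamma> + \<epsilon>\<close>, and minimise the convex functional
  \<open>cost h = E (max 0 (Phi (grad h) - c)) powr r\<close> over bounded \<open>h\<close>.  Strict convexity of \<open>t powr r\<close>
  makes the excesses of a minimising sequence converge in \<open>L\<^sup>r\<close>, hence dominated along a subsequence.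
  An upper bound on \<open>Phi (grad h)\<close> bounds every \<open>grad h \<omega> e\<close> from above, and since
  \<open>grad h (T e \<omega>) (-e) = - grad h \<omega> e\<close> it also bounds it from below; so a parallelogram argument in a
  weighted \<open>L\<^sup>2\<close> space yields minimisers \<open>y n\<close> whose gradients converge almost everywhere, dominated
  in \<open>L\<^sup>r\<close>, to some \<open>F\<close>, which is therefore in class K.  The first-order condition says that
  the tilted kernel \<open>q e \<propto> p e * exp (ip l e + F e)\<close> together with the density
  \<open>\<phi> \<propto> (max 0 (Phi F - c)) powr (r - 1)\<close> is stationary.  If \<open>\<phi>\<close> did not vanish, this pair would witness
  \<open>\<Gamma> \<ge> c\<close> because there \<open>Phi F > c\<close>; hence \<open>Phi F \<le> c\<close> almost everywhere.
\<close>

section \<open>The log-sum-exp function and powers\<close>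

definition lse :: "'e set \<Rightarrow> ('e \<Rightarrow> real) \<Rightarrow> ('e \<Rightarrow> real) \<Rightarrow> real" where
  "lse A w x = ln (\<Sum>e\<in>A. w e * exp (x e))"

text \<open>The gradient of \<open>lse A w\<close> at \<open>x\<close>. For probability weights
  \<open>w\<close> it is again a probability vector.\<close>

definition gibbs :: "'e set \<Rightarrow> ('e \<Rightarrow> real) \<Rightarrow> ('e \<Rightarrow> real) \<Rightarrow> 'e \<Rightarrow> real" where
  "gibbs A w x e = w e * exp (x e) / (\<Sum>e\<in>A. w e * exp (x e))"

locale prob_weights =
  fixes A :: "'e set" and w :: "'e \<Rightarrow> real"
  assumes nonneg: "\<And>e. e \<in> A \<Longrightarrow> 0 \<le> w e"
    and sum_weights: "(\<Sum>e\<in>A. w e) = 1"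
begin

lemma fin: "finite A"
  using sum_weights sum.infinite by fastforce

lemma partition_pos: "0 < (\<Sum>e\<in>A. w e * exp (x e))"
proof -
  obtain e where e: "e \<in> A" "w e \<noteq> 0"
    using sum_weights by (metis sum.neutral zero_neq_one)
  then show ?thesis
    using nonneg by (intro sum_pos2[OF fin e(1)]) (auto simp: less_le)
qed

lemma exp_lse: "exp (lse A w x) = (\<Sum>e\<in>A. w e * exp (x e))"
  unfolding lse_def using partition_pos by simp

lemma gibbs_eq: "gibbs A w x e = w e * exp (x e - lse A w x)"
  unfolding gibbs_def exp_diff exp_lse by simp

lemma gibbs_nonneg: "e \<in> A \<Longrightarrow> 0 \<le> gibbs A w x e"
  unfolding gibbs_eq using nonneg by simp

lemma sum_gibbs: "(\<Sum>e\<in>A. gibbs A w x e) = 1"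
  unfolding gibbs_def sum_divide_distrib[symmetric] using partition_pos[of x] by simp

lemma gibbs_le_1: "e \<in> A \<Longrightarrow> gibbs A w x e \<le> 1"
  using member_le_sum[of e A "gibbs A w x"] gibbs_nonneg fin sum_gibbs[of x] by auto

lemma abs_gibbs_sum_le:
  assumes "\<And>e. e \<in> A \<Longrightarrow> \<bar>v e\<bar> \<le> R"
  shows "\<bar>\<Sum>e\<in>A. gibbs A w x e * v e\<bar> \<le> R"
proof -
  have "\<bar>\<Sum>e\<in>A. gibbs A w x e * v e\<bar> \<le> (\<Sum>e\<in>A. gibbs A w x e * R)"
    using assms gibbs_nonneg
    by (intro order_trans[OF sum_abs] sum_mono) (auto simp: abs_mult intro!: mult_left_mono)
  then show ?thesis
    by (simp add: sum_gibbs flip: sum_distrib_right)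
qed

text \<open>Jensen's inequality for the Gibbs measure at \<open>z\<close>: the ratio of the two
  partition functions is the Gibbs mean of \<open>exp (y e - z e)\<close>, hence at least the
  exponential of the mean \<open>m\<close>.\<close>

lemma lse_tangent:
  "lse A w z + (\<Sum>e\<in>A. gibbs A w z e * (y e - z e)) \<le> lse A w y"
proof -
  define m where "m = (\<Sum>e\<in>A. gibbs A w z e * (y e - z e))"
  \<comment> \<open>The tangent line of \<open>exp\<close> at \<open>m\<close>, evaluated at
    \<open>y e - z e\<close> and averaged: its linear part has mean zero by the choice of
    \<open>m\<close>. Comparing it termwise with \<open>exp\<close> proves Jensen's inequality
    here.\<close>
  have "exp m = (\<Sum>e\<in>A. gibbs A w z e * (exp m * (1 + ((y e - z e) - m))))"
  proof -
    have "(\<Sum>e\<in>A. gibbs A w z e * (exp m * (1 + ((y e - z e) - m)))) =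
      exp m * (\<Sum>e\<in>A. gibbs A w z e * (1 - m)) + exp m * (\<Sum>e\<in>A. gibbs A w z e * (y e - z e))"
      unfolding sum_distrib_left sum.distrib[symmetric] by (intro sum.cong) (auto simp: algebra_simps)
    also have "\<dots> = exp m * (1 - m) + exp m * m"
      by (simp only: sum_gibbs m_def[symmetric] sum_distrib_right[symmetric] mult_1_left)
    also have "\<dots> = exp m"
      by (simp add: algebra_simps)
    finally show ?thesis by simp
  qed
  also have "\<dots> \<le> (\<Sum>e\<in>A. gibbs A w z e * exp (y e - z e))"
  proof (intro sum_mono mult_left_mono gibbs_nonneg)
    fix e
    have "exp m * (1 + ((y e - z e) - m)) \<le> exp m * exp ((y e - z e) - m)"
      by (intro mult_left_mono exp_ge_add_one_self) auto
    then show "exp m * (1 + ((y e - z e) - m)) \<le> exp (y e - z e)"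
      by (simp flip: exp_add)
  qed
  also have "\<dots> = exp (lse A w y) / exp (lse A w z)"
    unfolding gibbs_def exp_lse sum_divide_distrib by (intro sum.cong) (auto simp: exp_diff)
  also have "\<dots> = exp (lse A w y - lse A w z)"
    by (simp add: exp_diff)
  finally show ?thesis
    unfolding m_def by simp
qed

text \<open>Tangents at the midpoint \<open>z\<close> towards both endpoints are added; their linear
  terms cancel.\<close>

lemma lse_midpoint:
  "lse A w (\<lambda>e. (x e + y e) / 2) \<le> (lse A w x + lse A w y) / 2"
proof -
  define z where "z e = (x e + y e) / 2" for e
  have "(\<Sum>e\<in>A. gibbs A w z e * (x e - z e)) + (\<Sum>e\<in>A. gibbs A w z e * (y e - z e)) = 0"
    unfolding sum.distrib[symmetric] by (intro sum.neutral ballI) (simp add: z_def field_simps)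
  moreover have "m \<le> (a + b) / 2" if "s + t = 0" "m + s \<le> a" "m + t \<le> b" for m s t a b :: real
    using that by (simp add: field_simps)
  ultimately have "lse A w z \<le> (lse A w x + lse A w y) / 2"
    using lse_tangent by blast
  then show ?thesis
    by (simp add: z_def[abs_def])
qed

text \<open>The gradient is a probability vector, so \<open>lse\<close> is 1-Lipschitz for the sup
  norm.\<close>

lemma lse_shift_le:
  assumes "\<And>e. e \<in> A \<Longrightarrow> \<bar>x e - y e\<bar> \<le> R"
  shows "lse A w x \<le> lse A w y + R"
  using lse_tangent[of x y] abs_gibbs_sum_le[of "\<lambda>e. y e - x e" R x] assms
  by (auto simp: abs_minus_commute)

lemma lse_zero: "lse A w (\<lambda>_. 0) = 0"
  by (simp add: lse_def sum_weights)

text \<open>One summand is at most the whole partition function. This is what turns an upper bound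
  on \<open>Phi\<close> into upper bounds on single components.\<close>

lemma component_le_lse:
  assumes "e \<in> A" "0 < w e"
  shows "x e \<le> lse A w x - ln (w e)"
proof -
  have "w e * exp (x e) \<le> exp (lse A w x)"
    unfolding exp_lse using assms nonneg by (intro member_le_sum fin) auto
  then have "exp (ln (w e) + x e) \<le> exp (lse A w x)"
    using assms by (simp add: exp_add)
  then show ?thesis by simp
qed

lemma tendsto_lse:
  assumes "\<And>e. e \<in> A \<Longrightarrow> ((\<lambda>n. x n e) \<longlongrightarrow> y e) F"
  shows "((\<lambda>n. lse A w (x n)) \<longlongrightarrow> lse A w y) F"
  unfolding lse_def using partition_pos[of y]
  by (intro tendsto_intros assms) auto

lemma tendsto_gibbs:
  assumes "\<And>e. e \<in> A \<Longrightarrow> ((\<lambda>n. x n e) \<longlongrightarrow> y e) F" "e \<in> A"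
  shows "((\<lambda>n. gibbs A w (x n) e) \<longlongrightarrow> gibbs A w y e) F"
  unfolding gibbs_def using partition_pos[of y]
  by (intro tendsto_intros assms) auto

end

section \<open>Convexity inequalities for powers\<close>

lemma powr_tangent:
  fixes r x y :: real
  assumes r: "1 < r" and "0 \<le> x" "0 \<le> y"
  shows "x powr r - y powr r \<le> r * x powr (r - 1) * (x - y)"
proof (cases "x = 0 \<or> y = 0")
  case True
  \<comment> \<open>The mean value argument needs positive points. With \<open>y = 0\<close> the
    claim reduces to \<open>x powr r <= r * x powr r\<close>; with \<open>x = 0\<close> the left
    side is not positive.\<close>
  moreover have "x powr r \<le> r * x powr r"
    using r mult_right_mono[of 1 r "x powr r"] by simp
  moreover have "x powr (r - 1) * x = x powr r" if "x \<noteq> 0"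
    using that assms by (simp add: powr_diff)
  then have "r * (x powr (r - 1) * x) = r * x powr r"
    by (cases "x = 0") auto
  ultimately show ?thesis
    using assms by (auto simp: mult.assoc)
next
  case False
  then have p: "0 < x" "0 < y" using assms by auto
  have d: "((\<lambda>t. t powr r) has_real_derivative r * t powr (r - 1)) (at t)" if "t > 0" for t :: real
    using that by (auto intro!: derivative_eq_intros)
  consider "x = y" | "y < x" | "x < y" by linarith
  then show ?thesis
  proof cases
    case 2
    obtain z where z: "y < z" "z < x" "x powr r - y powr r = (x - y) * (r * z powr (r - 1))"
      using MVT2[OF 2, of "\<lambda>t. t powr r" "\<lambda>t. r * t powr (r - 1)"] d p by force
    have "z powr (r - 1) \<le> x powr (r - 1)"
      using z p r by (intro powr_mono2) auto
    then have "(x - y) * (r * z powr (r - 1)) \<le> (x - y) * (r * x powr (r - 1))"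
      using 2 r by (intro mult_left_mono) auto
    then show ?thesis using z by (simp add: mult_ac)
  next
    case 3
    obtain z where z: "x < z" "z < y" "y powr r - x powr r = (y - x) * (r * z powr (r - 1))"
      using MVT2[OF 3, of "\<lambda>t. t powr r" "\<lambda>t. r * t powr (r - 1)"] d p by force
    have "x powr (r - 1) \<le> z powr (r - 1)"
      using z p r by (intro powr_mono2) auto
    then have "(y - x) * (r * x powr (r - 1)) \<le> (y - x) * (r * z powr (r - 1))"
      using 3 r by (intro mult_left_mono) auto
    then show ?thesis using z by (simp add: algebra_simps)
  qed simp
qed

lemma powr_midpoint:
  fixes r x y :: real
  assumes "1 < r" "0 \<le> x" "0 \<le> y"
  shows "((x + y) / 2) powr r \<le> (x powr r + y powr r) / 2"
proof -
  let ?z = "(x + y) / 2"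
  have "?z powr r - x powr r + (?z powr r - y powr r)
    \<le> r * ?z powr (r - 1) * (?z - x) + r * ?z powr (r - 1) * (?z - y)"
    using assms by (intro add_mono powr_tangent) auto
  also have "\<dots> = r * ?z powr (r - 1) * ((?z - x) + (?z - y))"
    by (simp only: distrib_left)
  also have "(?z - x) + (?z - y) = 0" by (simp add: field_simps)
  finally show ?thesis by simp
qed

text \<open>A quantitative form of strict convexity. By homogeneity only the pairs
  \<open>(t, 1)\<close> with \<open>t\<close> in the unit interval matter. For \<open>t\<close> near
  1 the \<open>\<eta>\<close> term suffices, and for the other \<open>t\<close> the midpoint gap is
  bounded away from zero.\<close>

lemma powr_midpoint_gap:
  fixes r \<eta> :: real
  assumes r: "1 < r" and eta: "0 < \<eta>" "\<eta> < 1"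
  obtains C where "0 < C" "\<And>u v. \<lbrakk>0 \<le> u; 0 \<le> v\<rbrakk> \<Longrightarrow> \<bar>u powr r - v powr r\<bar> \<le>
    \<eta> * (u powr r + v powr r) + C * ((u powr r + v powr r) / 2 - ((u + v) / 2) powr r)"
proof -
  define g where "g t = (1 + t powr r) / 2 - ((1 + t) / 2) powr r" for t :: real
  \<comment> \<open>The derivative of the gap is negative because \<open>t < (1 + t) / 2\<close> for
    \<open>t < 1\<close>.\<close>
  have gdec: "g y < g x" if "0 \<le> x" "x < y" "y \<le> 1" for x y
  proof (rule DERIV_neg_imp_decreasing_open[OF that(2)])
    fix t assume t: "x < t" "t < y"
    have "(g has_real_derivative (r * t powr (r - 1)) / 2 - r * ((1 + t) / 2) powr (r - 1) / 2) (at t)"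
      unfolding g_def using t that by (auto intro!: derivative_eq_intros)
    moreover have "t powr (r - 1) < ((1 + t) / 2) powr (r - 1)"
      using t that r by (intro powr_less_mono2) auto
    ultimately show "\<exists>d. (g has_real_derivative d) (at t) \<and> d < 0"
      using r by (intro exI[of _ "(r * t powr (r - 1)) / 2 - r * ((1 + t) / 2) powr (r - 1) / 2"]) auto
  next
    show "continuous_on {x..y} g"
      unfolding g_def using that r by (intro continuous_intros continuous_on_powr') auto
  qed
  have g1: "g 1 = 0" by (simp add: g_def)
  have g0: "0 \<le> g t" if "0 \<le> t" "t \<le> 1" for t
    using gdec[of t 1] g1 that by (cases "t = 1") auto
  \<comment> \<open>The threshold where \<open>1 - t powr r\<close> equals \<open>\<eta>\<close>.
    Below it, monotonicity of \<open>g\<close> and the choice \<open>C = 1 / g t0\<close> give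
    \<open>C * g t >= 1\<close>.\<close>
  define t0 where "t0 = (1 - \<eta>) powr (1 / r)"
  have t0: "0 < t0" "t0 < 1"
    unfolding t0_def using eta r powr_less_mono2[of "1 / r" "1 - \<eta>" 1] by auto
  have t0r: "t0 powr r = 1 - \<eta>"
    unfolding t0_def using eta r by (simp add: powr_powr)
  define C where "C = 1 / g t0"
  have Cpos: "0 < C" "0 < g t0"
    using gdec[of t0 1] t0 g1 by (auto simp: C_def)
  have unit: "1 - t powr r \<le> \<eta> * (1 + t powr r) + C * g t" if "0 \<le> t" "t \<le> 1" for t
  proof (cases "t \<le> t0")
    case True
    then have "g t0 \<le> g t" using gdec[of t t0] that t0 by (cases "t = t0") auto
    then have "1 \<le> C * g t" unfolding C_def using Cpos(2) by simp
    moreover have "0 \<le> \<eta> * (1 + t powr r)" "0 \<le> t powr r" using eta by auto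
    ultimately show ?thesis by linarith
  next
    case False
    then have "t0 powr r \<le> t powr r" using t0 r by (intro powr_mono2) auto
    moreover have "\<eta> * 1 \<le> \<eta> * (1 + t powr r)" using eta by (intro mult_left_mono) auto
    moreover have "0 \<le> C * g t" using Cpos g0[OF that] by auto
    ultimately show ?thesis using t0r by linarith
  qed
  have ordered: "v powr r - u powr r \<le>
    \<eta> * (u powr r + v powr r) + C * ((u powr r + v powr r) / 2 - ((u + v) / 2) powr r)"
    if uv: "0 \<le> u" "u \<le> v" for u v
  proof (cases "v = 0")
    case False
    then have v: "0 < v" using uv by auto
    define t where "t = u / v"
    have t: "0 \<le> t" "t \<le> 1" "u = t * v" using v uv by (auto simp: t_def)
    have "u powr r = t powr r * v powr r" unfolding t(3) using t v by (simp add: powr_mult)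
    moreover have "((u + v) / 2) powr r = ((1 + t) / 2) powr r * v powr r"
    proof -
      have "(u + v) / 2 = (1 + t) / 2 * v" using t by (simp add: field_simps)
      then show ?thesis using t v by (simp only: powr_mult)
    qed
    ultimately have "\<eta> * (u powr r + v powr r) + C * ((u powr r + v powr r) / 2 - ((u + v) / 2) powr r)
        - (v powr r - u powr r) = (\<eta> * (1 + t powr r) + C * g t - (1 - t powr r)) * v powr r"
      by (simp add: g_def field_simps)
    also have "0 \<le> \<dots>" using unit[OF t(1,2)] by (intro mult_nonneg_nonneg) auto
    finally show ?thesis by linarith
  qed (use uv in auto)
  have "\<bar>u powr r - v powr r\<bar> \<le>
    \<eta> * (u powr r + v powr r) + C * ((u powr r + v powr r) / 2 - ((u + v) / 2) powr r)"
    if "0 \<le> u" "0 \<le> v" for u v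
  proof (cases "u \<le> v")
    case True
    then have "u powr r \<le> v powr r" using that r by (intro powr_mono2) auto
    then show ?thesis using ordered[of u v] that True by linarith
  next
    case False
    then have "v powr r \<le> u powr r" using that r by (intro powr_mono2) auto
    then show ?thesis using ordered[of v u] that False by (simp add: add.commute)
  qed
  then show ?thesis using that Cpos(1) by blast
qed

lemma powr_add_le:
  fixes r x y :: real
  assumes "0 \<le> r" "0 \<le> x" "0 \<le> y"
  shows "(x + y) powr r \<le> 2 powr r * (x powr r + y powr r)"
proof -
  have "(x + y) powr r \<le> (2 * max x y) powr r"
    using assms by (intro powr_mono2) auto
  also have "\<dots> = 2 powr r * max x y powr r"
    using assms by (simp add: powr_mult)
  also have "\<dots> \<le> 2 powr r * (x powr r + y powr r)"
    by (intro mult_left_mono) (auto simp: max_def)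
  finally show ?thesis .
qed

section \<open>Almost minimising sequences and rapidly Cauchy sequences\<close>

text \<open>The infima of \<open>N\<close> over the shrinking sets increase to a finite limit
  \<open>L\<close>. Once the infimum over \<open>S (\<rho> k)\<close> is within
  \<open>\<eta> k / 2\<close> of \<open>L\<close>, the later point \<open>y (Suc k)\<close> is
  almost as good as any competitor in the larger set \<open>S (\<rho> k)\<close>, so both neighbours
  can be compared with their midpoint.\<close>

lemma near_minimizers:
  fixes N :: "'b \<Rightarrow> real" and S :: "nat \<Rightarrow> 'b set" and \<eta> :: "nat \<Rightarrow> real"
  assumes ne: "\<And>n. S n \<noteq> {}" and dec: "\<And>m n. m \<le> n \<Longrightarrow> S n \<subseteq> S m"
    and bd: "\<And>x. x \<in> S 0 \<Longrightarrow> 0 \<le> N x \<and> N x \<le> C"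
    and eta: "\<And>n. 0 < \<eta> n" "decseq \<eta>"
  obtains y \<rho> where "mono \<rho>" "\<And>k. k \<le> \<rho> k" "\<And>k. y k \<in> S (\<rho> k)"
    "\<And>k z. z \<in> S (\<rho> k) \<Longrightarrow> N (y k) \<le> N z + \<eta> k \<and> N (y (Suc k)) \<le> N z + \<eta> k"
proof -
  define I where "I n = Inf (N ` S n)" for n
  have bb: "bdd_below (N ` S n)" for n
    using bd dec[of 0 n] by (intro bdd_belowI[of _ 0]) auto
  have le: "I n \<le> N z" if "z \<in> S n" for n z
    unfolding I_def using that bb by (intro cInf_lower) auto
  have inc: "I m \<le> I n" if "m \<le> n" for m n
    unfolding I_def using bb ne dec[OF that] by (intro cInf_superset_mono image_mono) auto
  have "I n \<le> C" for n
  proof -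
    obtain z where "z \<in> S n" using ne by blast
    then show ?thesis using le[of z n] bd dec[of 0 n] by force
  qed
  then have ba: "bdd_above (range I)" by (auto intro!: bdd_aboveI)
  define L where "L = Sup (range I)"
  have IL: "I n \<le> L" for n
    unfolding L_def using ba by (intro cSup_upper) auto
  have "\<exists>n. L - \<eta> k / 2 < I n" for k
    unfolding L_def using eta(1)[of k] less_cSup_iff[OF _ ba, of "Sup (range I) - \<eta> k / 2"] by auto
  then obtain n where n: "\<And>k. L - \<eta> k / 2 < I (n k)" by metis
  \<comment> \<open>Partial sums make \<open>\<rho>\<close> monotone and at least
    \<open>n k\<close>; the summand \<open>k\<close> makes it at least \<open>k\<close>.\<close>
  define \<rho> where "\<rho> k = (\<Sum>j\<le>k. n j) + k" for k
  have nr: "n k \<le> \<rho> k" for k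
    unfolding \<rho>_def by (simp add: lessThan_Suc_atMost[symmetric])
  have "\<exists>y\<in>S (\<rho> k). N y < I (\<rho> k) + \<eta> k / 2" for k
    using cInf_lessD[of "N ` S (\<rho> k)" "I (\<rho> k) + \<eta> k / 2"] eta(1)[of k] ne
    unfolding I_def by auto
  then obtain y where y: "\<And>k. y k \<in> S (\<rho> k)" "\<And>k. N (y k) < I (\<rho> k) + \<eta> k / 2" by metis
  show ?thesis
  proof (rule that[of \<rho> y])
    show "mono \<rho>" unfolding \<rho>_def by (intro monoI add_mono sum_mono2) auto
    show "k \<le> \<rho> k" for k by (simp add: \<rho>_def)
    show "y k \<in> S (\<rho> k)" for k by (rule y)
    fix k z assume z: "z \<in> S (\<rho> k)"
    have "L - \<eta> k / 2 < N z" using n[of k] inc[OF nr[of k]] le[OF z] by linarith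
    moreover have "\<eta> (Suc k) \<le> \<eta> k" using eta(2) by (simp add: decseq_SucD)
    ultimately show "N (y k) \<le> N z + \<eta> k \<and> N (y (Suc k)) \<le> N z + \<eta> k"
      using y(2)[of k] y(2)[of "Suc k"] IL[of "\<rho> k"] IL[of "\<rho> (Suc k)"] by linarith
  qed
qed

text \<open>The increments have a summable series of integrals, so they are absolutely summable
  almost everywhere. The bound \<open>V\<close> is the first term plus the sum of all absolute
  increments.\<close>

lemma fast_L1_Cauchy:
  fixes u :: "nat \<Rightarrow> 'a \<Rightarrow> real"
  assumes int: "\<And>n. integrable M (u n)"
    and fast: "\<And>n. (\<integral>\<omega>. \<bar>u (Suc n) \<omega> - u n \<omega>\<bar> \<partial>M) \<le> (1 / 2) ^ n"
  obtains V where "integrable M V" "AE \<omega> in M. (\<forall>n. \<bar>u n \<omega>\<bar> \<le> V \<omega>) \<and> convergent (\<lambda>n. u n \<omega>)"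
proof -
  let ?d = "\<lambda>n \<omega>. \<bar>u (Suc n) \<omega> - u n \<omega>\<bar>"
  have idf: "integrable M (?d n)" for n using int by auto
  have [measurable]: "u n \<in> borel_measurable M" for n using int by auto
  have "(\<integral>\<^sup>+\<omega>. (\<Sum>n. ennreal (?d n \<omega>)) \<partial>M) = (\<Sum>n. \<integral>\<^sup>+\<omega>. ennreal (?d n \<omega>) \<partial>M)"
    by (intro nn_integral_suminf) measurable
  also have "\<dots> \<le> (\<Sum>n. ennreal ((1 / 2) ^ n))"
    using fast by (intro suminf_le summableI) (simp add: nn_integral_eq_integral[OF idf] ennreal_leI)
  also have "\<dots> < \<infinity>"
    by (simp add: suminf_ennreal_eq[OF _ power_half_series] summable_geometric suminf_ennreal2)
  finally have fin: "(\<integral>\<^sup>+\<omega>. (\<Sum>n. ennreal (?d n \<omega>)) \<partial>M) < \<infinity>" .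
  then have "AE \<omega> in M. (\<Sum>n. ennreal (?d n \<omega>)) \<noteq> \<infinity>"
    by (intro nn_integral_noteq_infinite) auto
  then have ae: "AE \<omega> in M. summable (\<lambda>n. ?d n \<omega>)"
    by eventually_elim (simp add: summable_suminf_not_top)
  define V where "V \<omega> = \<bar>u 0 \<omega>\<bar> + (\<Sum>n. ?d n \<omega>)" for \<omega>
  show ?thesis
  proof (rule that[of V])
    have "summable (\<lambda>n. \<integral>\<omega>. norm (?d n \<omega>) \<partial>M)"
      using fast by (intro summable_comparison_test'[OF summable_geometric[of "1 / 2 :: real"], of 0]) simp_all
    then have "integrable M (\<lambda>\<omega>. \<Sum>n. ?d n \<omega>)"
      using ae by (intro integrable_suminf idf) auto
    then show "integrable M V"
      unfolding V_def using int by auto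
    from ae show "AE \<omega> in M. (\<forall>n. \<bar>u n \<omega>\<bar> \<le> V \<omega>) \<and> convergent (\<lambda>n. u n \<omega>)"
    proof eventually_elim
      case (elim \<omega>)
      have tel: "(\<Sum>k<n. u (Suc k) \<omega> - u k \<omega>) = u n \<omega> - u 0 \<omega>" for n
        by (rule sum_lessThan_telescope)
      have "\<bar>u n \<omega>\<bar> \<le> V \<omega>" for n
      proof -
        have "\<bar>u n \<omega> - u 0 \<omega>\<bar> \<le> (\<Sum>k<n. ?d k \<omega>)"
          unfolding tel[symmetric] by (rule sum_abs)
        also have "\<dots> \<le> (\<Sum>k. ?d k \<omega>)"
          using elim by (intro sum_le_suminf) auto
        finally show ?thesis unfolding V_def by linarith
      qed
      moreover have "summable (\<lambda>n. u (Suc n) \<omega> - u n \<omega>)"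
        using elim by (rule summable_rabs_cancel)
      then have "convergent (\<lambda>n. (u n \<omega> - u 0 \<omega>) + u 0 \<omega>)"
        unfolding summable_iff_convergent tel by (intro convergent_add convergent_const)
      ultimately show ?case by simp
    qed
  qed
qed

section \<open>Measure-preserving maps and the random environment\<close>

text \<open>Membership in the Lebesgue space with exponent \<open>r\<close>. Measurability is stated
  separately because it does not follow from that of the power of the absolute value.\<close>

definition Lr :: "'a measure \<Rightarrow> real \<Rightarrow> ('a \<Rightarrow> real) \<Rightarrow> bool" where
  "Lr M r f \<longleftrightarrow> f \<in> borel_measurable M \<and> integrable M (\<lambda>\<omega>. \<bar>f \<omega>\<bar> powr r)"

lemma Lr_measurable[measurable_dest]: "Lr M r f \<Longrightarrow> f \<in> borel_measurable M"
  by (simp add: Lr_def)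

lemma Lr_mono:
  assumes "Lr M r f" "0 \<le> r" "g \<in> borel_measurable M" "AE \<omega> in M. \<bar>g \<omega>\<bar> \<le> \<bar>f \<omega>\<bar>"
  shows "Lr M r g"
  unfolding Lr_def
proof (intro conjI assms)
  have [measurable]: "g \<in> borel_measurable M" by fact
  have int: "integrable M (\<lambda>\<omega>. \<bar>f \<omega>\<bar> powr r)" using assms(1) by (simp add: Lr_def)
  show "integrable M (\<lambda>\<omega>. \<bar>g \<omega>\<bar> powr r)"
  proof (rule Bochner_Integration.integrable_bound[OF int])
    show "AE \<omega> in M. norm (\<bar>g \<omega>\<bar> powr r) \<le> norm (\<bar>f \<omega>\<bar> powr r)"
      using assms(4) by eventually_elim (auto intro: powr_mono2 assms)
  qed measurable
qed

lemma Lr_add: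
  assumes "Lr M r f" "Lr M r g" "0 \<le> r"
  shows "Lr M r (\<lambda>\<omega>. f \<omega> + g \<omega>)"
  unfolding Lr_def
proof
  have [measurable]: "f \<in> borel_measurable M" "g \<in> borel_measurable M"
    using assms by (auto simp: Lr_def)
  show "(\<lambda>\<omega>. f \<omega> + g \<omega>) \<in> borel_measurable M" by measurable
  have int: "integrable M (\<lambda>\<omega>. 2 powr r * (\<bar>f \<omega>\<bar> powr r + \<bar>g \<omega>\<bar> powr r))"
    using assms by (auto simp: Lr_def)
  show "integrable M (\<lambda>\<omega>. \<bar>f \<omega> + g \<omega>\<bar> powr r)"
  proof (rule Bochner_Integration.integrable_bound[OF int])
    have "\<bar>f \<omega> + g \<omega>\<bar> powr r \<le> 2 powr r * (\<bar>f \<omega>\<bar> powr r + \<bar>g \<omega>\<bar> powr r)" for \<omega>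
      using powr_mono2[OF assms(3) _ abs_triangle_ineq, of "f \<omega>" "g \<omega>"]
        powr_add_le[OF assms(3), of "\<bar>f \<omega>\<bar>" "\<bar>g \<omega>\<bar>"] by auto
    then show "AE \<omega> in M. norm (\<bar>f \<omega> + g \<omega>\<bar> powr r) \<le> norm (2 powr r * (\<bar>f \<omega>\<bar> powr r + \<bar>g \<omega>\<bar> powr r))"
      by simp
  qed measurable
qed

lemma Lr_zero: "Lr M r (\<lambda>_. 0)"
  by (simp add: Lr_def)

lemma Lr_sum:
  assumes "\<And>i. i \<in> I \<Longrightarrow> Lr M r (f i)" "0 \<le> r"
  shows "Lr M r (\<lambda>\<omega>. \<Sum>i\<in>I. f i \<omega>)"
  using assms(1)
proof (induction I rule: infinite_finite_induct)
  case (insert i I)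
  then show ?case using Lr_add[of M r "f i" "\<lambda>\<omega>. \<Sum>i\<in>I. f i \<omega>"] assms(2) by simp
qed (simp_all add: Lr_zero)

lemma Lr_abs: "Lr M r f \<Longrightarrow> Lr M r (\<lambda>\<omega>. \<bar>f \<omega>\<bar>)"
  by (auto simp: Lr_def intro: borel_measurable_abs)

context prob_space
begin

lemma Lr_const: "Lr M r (\<lambda>_. k)"
  by (simp add: Lr_def)

lemma Lr_integrable:
  assumes "Lr M r f" "1 \<le> r"
  shows "integrable M f"
proof -
  have int: "integrable M (\<lambda>\<omega>. 1 + \<bar>f \<omega>\<bar> powr r)" using assms by (auto simp: Lr_def)
  have "\<bar>f \<omega>\<bar> \<le> 1 + \<bar>f \<omega>\<bar> powr r" for \<omega>
  proof (cases "\<bar>f \<omega>\<bar> \<le> 1")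
    case False
    then show ?thesis using powr_mono[OF assms(2), of "\<bar>f \<omega>\<bar>"] by simp
  qed (simp add: add_increasing2)
  then show ?thesis
    using assms by (intro Bochner_Integration.integrable_bound[OF int]) (auto simp: Lr_def)
qed

end

section \<open>Measure-preserving maps and the lattice action\<close>

lemma measure_preserving_distr:
  assumes "measure_preserving_map M S"
  shows "distr M M S = M"
  using assms unfolding measure_preserving_map_def
  by (intro measure_eqI) (auto simp: emeasure_distr)

lemma measure_preserving_AE:
  assumes "measure_preserving_map M S" "AE \<omega> in M. P \<omega>"
  shows "AE \<omega> in M. P (S \<omega>)"
proof -
  have "AE \<omega> in distr M M S. P \<omega>"
    using assms(2) by (simp only: measure_preserving_distr[OF assms(1)])
  then show ?thesis
    using assms(1) by (auto simp: measure_preserving_map_def dest: AE_distrD[rotated])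
qed

lemma measure_preserving_integral:
  fixes f :: "'a \<Rightarrow> real"
  assumes "measure_preserving_map M S" "f \<in> borel_measurable M"
  shows "(\<integral>\<omega>. f (S \<omega>) \<partial>M) = (\<integral>\<omega>. f \<omega> \<partial>M)"
    and "integrable M (\<lambda>\<omega>. f (S \<omega>)) \<longleftrightarrow> integrable M f"
  using integral_distr[of S M M f] integrable_distr_eq[of S M M f]
    measure_preserving_distr[OF assms(1)] assms
  by (auto simp: measure_preserving_map_def)

lemma measure_preserving_Lr:
  assumes "measure_preserving_map M S" "Lr M r f"
  shows "Lr M r (\<lambda>\<omega>. f (S \<omega>))"
  using assms measure_preserving_integral(2)[of M S "\<lambda>\<omega>. \<bar>f \<omega>\<bar> powr r"]
  by (auto simp: Lr_def measure_preserving_map_def)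

lemma measure_preserving_comp:
  assumes "measure_preserving_map M S" "measure_preserving_map M S'"
  shows "measure_preserving_map M (\<lambda>\<omega>. S (S' \<omega>))"
proof -
  have [measurable]: "S \<in> M \<rightarrow>\<^sub>M M" "S' \<in> M \<rightarrow>\<^sub>M M"
    using assms by (auto simp: measure_preserving_map_def)
  have "emeasure M ((\<lambda>\<omega>. S (S' \<omega>)) -` A \<inter> space M) = emeasure M A" if [measurable]: "A \<in> sets M" for A
  proof -
    have "(\<lambda>\<omega>. S (S' \<omega>)) -` A \<inter> space M = S' -` (S -` A \<inter> space M) \<inter> space M"
      using measurable_space[of S' M M] by auto
    moreover have "S -` A \<inter> space M \<in> sets M" by measurable
    ultimately show ?thesis
      using assms that unfolding measure_preserving_map_def by metis
  qed
  then show ?thesis by (simp add: measure_preserving_map_def)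
qed

lemma uminus_unitvecs: "e \<in> unitvecs \<Longrightarrow> - e \<in> unitvecs"
  by (simp add: unitvecs_def)

lemma axis_unitvecs: "axis i (1::int) \<in> unitvecs"
  by (simp add: unitvecs_def axis_def if_distrib[of "\<lambda>x. x ^ 2"] cong: if_cong)

text \<open>\<open>Zd_action\<close> asserts preservation for unit vectors only. Induction on the l1
  norm of \<open>x\<close> peels off one unit step at a time.\<close>

lemma Zd_action_measure_preserving:
  fixes T :: "int ^ 'n::finite \<Rightarrow> 'a \<Rightarrow> 'a"
  assumes act: "Zd_action M T"
  shows "measure_preserving_map M (T x)"
proof (induction "\<Sum>i\<in>UNIV. nat \<bar>x $ i\<bar>" arbitrary: x rule: less_induct)
  case less
  \<comment> \<open>The action laws hold only on \<open>space M\<close>, so maps are exchanged by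
    agreement there rather than by equality.\<close>
  have cong: "measure_preserving_map M S" if "\<And>\<omega>. \<omega> \<in> space M \<Longrightarrow> S \<omega> = S' \<omega>"
    "measure_preserving_map M S'" for S S' :: "'a \<Rightarrow> 'a"
  proof -
    have "S -` A \<inter> space M = S' -` A \<inter> space M" for A using that(1) by auto
    then show ?thesis
      using that measurable_cong[of M S S' M] by (auto simp: measure_preserving_map_def)
  qed
  show ?case
  proof (cases "x = 0")
    case True
    show ?thesis
      by (rule cong[of _ "\<lambda>\<omega>. \<omega>"])
        (use act True in \<open>auto simp: Zd_action_def measure_preserving_map_def Int_absorb2 sets.sets_into_space\<close>)
  next
    case False
    then obtain i where i: "x $ i \<noteq> 0" by (auto simp: vec_eq_iff)
    \<comment> \<open>A unit step in the direction of the sign of \<open>x $ i\<close>, so that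
      \<open>x - e\<close> is closer to the origin.\<close>
    define e where "e = (if 0 < x $ i then axis i 1 else - axis i (1::int))"
    have e: "e \<in> unitvecs" by (simp add: e_def axis_unitvecs uminus_unitvecs)
    have "(\<Sum>j\<in>UNIV. nat \<bar>(x - e) $ j\<bar>) < (\<Sum>j\<in>UNIV. nat \<bar>x $ j\<bar>)"
      by (rule sum_strict_mono_ex1) (use i in \<open>auto simp: e_def axis_def intro!: exI[of _ i]\<close>)
    then have "measure_preserving_map M (T (x - e))" by (rule less)
    moreover have "measure_preserving_map M (T e)" using act e by (simp add: Zd_action_def)
    ultimately have "measure_preserving_map M (\<lambda>\<omega>. T (x - e) (T e \<omega>))"
      by (rule measure_preserving_comp)
    moreover have "T x \<omega> = T (x - e) (T e \<omega>)" if "\<omega> \<in> space M" for \<omega>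
      using act that unfolding Zd_action_def by (metis diff_add_cancel)
    ultimately show ?thesis by (rule cong[rotated]) auto
  qed
qed

lemma ext_integral_integrable:
  assumes "integrable M g"
  shows "ext_integral M g = ereal (\<integral>\<omega>. g \<omega> \<partial>M)"
proof -
  have "(\<integral>\<^sup>+\<omega>. ennreal (g \<omega>) \<partial>M) \<noteq> \<infinity>" "(\<integral>\<^sup>+\<omega>. ennreal (- g \<omega>) \<partial>M) \<noteq> \<infinity>"
    using assms by (auto simp: real_integrable_def)
  then obtain a b where ab: "(\<integral>\<^sup>+\<omega>. ennreal (g \<omega>) \<partial>M) = ennreal a" "0 \<le> a"
    "(\<integral>\<^sup>+\<omega>. ennreal (- g \<omega>) \<partial>M) = ennreal b" "0 \<le> b"
    by (metis ennreal_cases infinity_ennreal_def)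
  then show ?thesis
    unfolding ext_integral_def real_lebesgue_integral_def[OF assms]
    by (simp add: enn2ereal_ennreal)
qed

section \<open>The random environment, gradients and the functional \<open>Phi\<close>\<close>

locale random_environment = prob_space M for M :: "'a measure" +
  fixes T :: "int ^ 'n::finite \<Rightarrow> 'a \<Rightarrow> 'a" and p :: "'a \<Rightarrow> int ^ 'n \<Rightarrow> real"
    and l :: "real ^ 'n" and r :: real
  assumes action: "Zd_action M T"
    and trans: "transition_fn M p"
    and r_gt_1: "1 < r"
    and p_pos: "\<And>e. e \<in> unitvecs \<Longrightarrow> AE \<omega> in M. 0 < p \<omega> e"
    and ln_p: "\<And>e. e \<in> unitvecs \<Longrightarrow> Lr M r (\<lambda>\<omega>. ln (p \<omega> e))"
begin

abbreviation U :: "(int ^ 'n) set" where "U \<equiv> unitvecs"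

definition grad :: "('a \<Rightarrow> real) \<Rightarrow> 'a \<Rightarrow> int ^ 'n \<Rightarrow> real" where
  "grad h \<omega> e = h \<omega> - h (T e \<omega>)"

text \<open>The function whose essential supremum has to be bounded, for the corrector
  \<open>x\<close>.\<close>

definition Phi :: "('a \<Rightarrow> int ^ 'n \<Rightarrow> real) \<Rightarrow> 'a \<Rightarrow> real" where
  "Phi x \<omega> = lse U (p \<omega>) (\<lambda>e. ip l e + x \<omega> e)"

text \<open>The gradient of \<open>Phi\<close> in \<open>x\<close>, and at the same time the kernel
  that attains the Gibbs variational formula for it.\<close>

definition tilt :: "('a \<Rightarrow> int ^ 'n \<Rightarrow> real) \<Rightarrow> 'a \<Rightarrow> int ^ 'n \<Rightarrow> real" where
  "tilt x \<omega> e = gibbs U (p \<omega>) (\<lambda>e. ip l e + x \<omega> e) e"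

lemma weights: "\<omega> \<in> space M \<Longrightarrow> prob_weights U (p \<omega>)"
  using trans by (intro prob_weights.intro) (auto simp: transition_fn_def)

lemma finite_U: "finite U"
  using weights not_empty prob_weights.fin by blast

lemma T_preserving: "measure_preserving_map M (T x)"
  using action by (rule Zd_action_measure_preserving)

lemma T_measurable[measurable]: "T x \<in> M \<rightarrow>\<^sub>M M"
  using T_preserving by (simp add: measure_preserving_map_def)

lemma T_space: "\<omega> \<in> space M \<Longrightarrow> T x \<omega> \<in> space M"
  using T_measurable by (rule measurable_space)

lemma T_add: "\<omega> \<in> space M \<Longrightarrow> T (x + y) \<omega> = T x (T y \<omega>)"
  using action by (simp add: Zd_action_def)

lemma T_zero: "\<omega> \<in> space M \<Longrightarrow> T 0 \<omega> = \<omega>"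
  using action by (simp add: Zd_action_def)

lemma T_minus: "\<omega> \<in> space M \<Longrightarrow> T (- x) (T x \<omega>) = \<omega>"
  using T_add[of \<omega> "- x" x] T_zero by simp

lemma p_measurable[measurable]: "e \<in> U \<Longrightarrow> (\<lambda>\<omega>. p \<omega> e) \<in> borel_measurable M"
  using trans by (simp add: transition_fn_def)

lemma AE_p_pos: "AE \<omega> in M. \<forall>e\<in>U. 0 < p \<omega> e"
  using p_pos finite_U by (simp add: AE_finite_all)

lemma AE_T: "AE \<omega> in M. P \<omega> \<Longrightarrow> AE \<omega> in M. P (T x \<omega>)"
  using T_preserving by (rule measure_preserving_AE)

lemma grad_measurable[measurable]:
  assumes [measurable]: "h \<in> borel_measurable M"
  shows "(\<lambda>\<omega>. grad h \<omega> e) \<in> borel_measurable M"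
  unfolding grad_def by measurable

lemma Phi_measurable:
  assumes [measurable]: "\<And>e. e \<in> U \<Longrightarrow> (\<lambda>\<omega>. x \<omega> e) \<in> borel_measurable M"
  shows "Phi x \<in> borel_measurable M"
  unfolding Phi_def[abs_def] lse_def by measurable

lemma tilt_measurable:
  assumes [measurable]: "\<And>e. e \<in> U \<Longrightarrow> (\<lambda>\<omega>. x \<omega> e) \<in> borel_measurable M" and "e \<in> U"
  shows "(\<lambda>\<omega>. tilt x \<omega> e) \<in> borel_measurable M"
proof -
  have [measurable]: "(\<lambda>\<omega>. p \<omega> e) \<in> borel_measurable M" "(\<lambda>\<omega>. x \<omega> e) \<in> borel_measurable M"
    using assms by auto
  show ?thesis
    unfolding tilt_def gibbs_def by measurable
qed

lemma Phi_tangent: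
  "\<omega> \<in> space M \<Longrightarrow> Phi z \<omega> - Phi y \<omega> \<le> (\<Sum>e\<in>U. tilt z \<omega> e * (z \<omega> e - y \<omega> e))"
  using prob_weights.lse_tangent[OF weights, of \<omega> "\<lambda>e. ip l e + z \<omega> e" "\<lambda>e. ip l e + y \<omega> e"]
  by (simp add: Phi_def tilt_def right_diff_distrib sum_subtractf)

lemma Phi_midpoint:
  "\<omega> \<in> space M \<Longrightarrow> Phi (\<lambda>\<omega> e. (x \<omega> e + y \<omega> e) / 2) \<omega> \<le> (Phi x \<omega> + Phi y \<omega>) / 2"
proof -
  assume "\<omega> \<in> space M"
  note prob_weights.lse_midpoint[OF weights[OF this], of "\<lambda>e. ip l e + x \<omega> e" "\<lambda>e. ip l e + y \<omega> e"]
  moreover have "(\<lambda>e. (ip l e + x \<omega> e + (ip l e + y \<omega> e)) / 2) = (\<lambda>e. ip l e + (x \<omega> e + y \<omega> e) / 2)"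
    by (simp add: fun_eq_iff field_simps)
  ultimately show ?thesis
    by (simp only: Phi_def)
qed

lemma Phi_shift_le:
  "\<lbrakk>\<omega> \<in> space M; \<And>e. e \<in> U \<Longrightarrow> \<bar>x \<omega> e - y \<omega> e\<bar> \<le> R\<rbrakk> \<Longrightarrow> Phi x \<omega> \<le> Phi y \<omega> + R"
  unfolding Phi_def by (rule prob_weights.lse_shift_le[OF weights]) auto

lemma component_le_Phi:
  "\<lbrakk>\<omega> \<in> space M; e \<in> U; 0 < p \<omega> e\<rbrakk> \<Longrightarrow> ip l e + x \<omega> e \<le> Phi x \<omega> - ln (p \<omega> e)"
  unfolding Phi_def
  using prob_weights.component_le_lse[OF weights, of \<omega> e "\<lambda>e. ip l e + x \<omega> e"] by simp

lemma tendsto_Phi: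
  assumes "\<omega> \<in> space M" "\<And>e. e \<in> U \<Longrightarrow> (\<lambda>n. x n \<omega> e) \<longlonglongrightarrow> y \<omega> e"
  shows "(\<lambda>n. Phi (x n) \<omega>) \<longlonglongrightarrow> Phi y \<omega>"
  unfolding Phi_def by (intro prob_weights.tendsto_lse[OF weights] tendsto_intros assms)

lemma tendsto_tilt:
  assumes "\<omega> \<in> space M" "\<And>e. e \<in> U \<Longrightarrow> (\<lambda>n. x n \<omega> e) \<longlonglongrightarrow> y \<omega> e" "e \<in> U"
  shows "(\<lambda>n. tilt (x n) \<omega> e) \<longlonglongrightarrow> tilt y \<omega> e"
  unfolding tilt_def by (intro prob_weights.tendsto_gibbs[OF weights] tendsto_intros assms)

lemma transition_tilt:
  assumes "\<And>e. e \<in> U \<Longrightarrow> (\<lambda>\<omega>. x \<omega> e) \<in> borel_measurable M"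
  shows "transition_fn M (tilt x)"
  unfolding transition_fn_def
  using tilt_measurable[OF assms] prob_weights.gibbs_nonneg[OF weights]
    prob_weights.gibbs_le_1[OF weights] prob_weights.sum_gibbs[OF weights]
  by (auto simp: tilt_def[abs_def])

lemma bounded_measurableD: "bounded_measurable M h \<Longrightarrow> h \<in> borel_measurable M"
  by (simp add: bounded_measurable_def)

lemma grad_bounded:
  assumes "bounded_measurable M h"
  obtains R where "0 \<le> R" "\<And>\<omega> e. \<omega> \<in> space M \<Longrightarrow> \<bar>grad h \<omega> e\<bar> \<le> R"
proof -
  obtain B where B: "\<And>\<omega>. \<omega> \<in> space M \<Longrightarrow> \<bar>h \<omega>\<bar> \<le> B"
    using assms by (auto simp: bounded_measurable_def)
  have "\<bar>grad h \<omega> e\<bar> \<le> 2 * \<bar>B\<bar>" if "\<omega> \<in> space M" for \<omega> e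
    using B[OF that] B[OF T_space[OF that, of e]] unfolding grad_def by linarith
  then show ?thesis by (intro that[of "2 * \<bar>B\<bar>"]) auto
qed

lemma grad_midpoint: "grad (\<lambda>\<omega>. (h \<omega> + g \<omega>) / 2) = (\<lambda>\<omega> e. (grad h \<omega> e + grad g \<omega> e) / 2)"
  by (simp add: fun_eq_iff grad_def field_simps)

lemma bounded_measurable_midpoint:
  assumes "bounded_measurable M h" "bounded_measurable M g"
  shows "bounded_measurable M (\<lambda>\<omega>. (h \<omega> + g \<omega>) / 2)"
proof -
  obtain A B where "\<And>\<omega>. \<omega> \<in> space M \<Longrightarrow> \<bar>h \<omega>\<bar> \<le> A" "\<And>\<omega>. \<omega> \<in> space M \<Longrightarrow> \<bar>g \<omega>\<bar> \<le> B"
    using assms by (auto simp: bounded_measurable_def)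
  then have "\<bar>h \<omega>\<bar> \<le> A" "\<bar>g \<omega>\<bar> \<le> B" if "\<omega> \<in> space M" for \<omega>
    using that by auto
  then have "\<bar>(h \<omega> + g \<omega>) / 2\<bar> \<le> A + B" if "\<omega> \<in> space M" for \<omega>
    using that by (fastforce simp: abs_le_iff field_simps)
  moreover have "(\<lambda>\<omega>. (h \<omega> + g \<omega>) / 2) \<in> borel_measurable M"
    using assms by (auto simp: bounded_measurable_def)
  ultimately show ?thesis unfolding bounded_measurable_def by blast
qed

lemma bounded_measurable_add_scaled:
  assumes "bounded_measurable M h" "bounded_measurable M g"
  shows "bounded_measurable M (\<lambda>\<omega>. h \<omega> + t * g \<omega>)"
proof -
  obtain A B where *: "\<And>\<omega>. \<omega> \<in> space M \<Longrightarrow> \<bar>h \<omega>\<bar> \<le> A" "\<And>\<omega>. \<omega> \<in> space M \<Longrightarrow> \<bar>g \<omega>\<bar> \<le> B"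
    using assms by (auto simp: bounded_measurable_def)
  have "\<bar>h \<omega> + t * g \<omega>\<bar> \<le> A + \<bar>t\<bar> * B" if "\<omega> \<in> space M" for \<omega>
    using *[OF that] mult_left_mono[of "\<bar>g \<omega>\<bar>" B "\<bar>t\<bar>"] abs_triangle_ineq[of "h \<omega>" "t * g \<omega>"]
    by (auto simp: abs_mult)
  moreover have "(\<lambda>\<omega>. h \<omega> + t * g \<omega>) \<in> borel_measurable M"
    using assms by (auto simp: bounded_measurable_def)
  ultimately show ?thesis by (auto simp: bounded_measurable_def)
qed

lemma integral_grad:
  assumes "bounded_measurable M h"
  shows "integrable M (\<lambda>\<omega>. grad h \<omega> e)" "(\<integral>\<omega>. grad h \<omega> e \<partial>M) = 0"
proof -
  have [measurable]: "h \<in> borel_measurable M" using assms by (rule bounded_measurableD)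
  obtain B where "\<And>\<omega>. \<omega> \<in> space M \<Longrightarrow> \<bar>h \<omega>\<bar> \<le> B"
    using assms by (auto simp: bounded_measurable_def)
  then have "integrable M h"
    by (intro integrable_const_bound[of _ B]) auto
  then show "integrable M (\<lambda>\<omega>. grad h \<omega> e)" "(\<integral>\<omega>. grad h \<omega> e \<partial>M) = 0"
    using measure_preserving_integral[OF T_preserving, of h e] unfolding grad_def by auto
qed

lemma grad_reverse: "\<omega> \<in> space M \<Longrightarrow> grad h (T e \<omega>) (- e) = - grad h \<omega> e"
  by (simp add: grad_def T_minus)

text \<open>The sum telescopes by \<open>T_add\<close>. The loop condition of \<open>classK\<close>
  is later obtained as a limit of these identities.\<close>

lemma loop_sum_grad:
  assumes "\<omega> \<in> space M" "hd xs = last xs"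
  shows "(\<Sum>i<length xs - 1. grad h (T (xs ! i) \<omega>) (xs ! Suc i - xs ! i)) = 0"
proof (cases "xs = []")
  case False
  have "grad h (T (xs ! i) \<omega>) (xs ! Suc i - xs ! i) = h (T (xs ! i) \<omega>) - h (T (xs ! Suc i) \<omega>)" for i
    using T_add[OF assms(1), of "xs ! Suc i - xs ! i" "xs ! i"] by (simp add: grad_def)
  then have "(\<Sum>i<length xs - 1. grad h (T (xs ! i) \<omega>) (xs ! Suc i - xs ! i))
    = h (T (xs ! 0) \<omega>) - h (T (xs ! (length xs - 1)) \<omega>)"
    using sum_lessThan_telescope'[of "\<lambda>i. h (T (xs ! i) \<omega>)" "length xs - 1"] by simp
  then show ?thesis using False assms(2) by (simp add: hd_conv_nth last_conv_nth)
qed simp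

section \<open>Lower bounds for \<open>Gamma\<close>\<close>

text \<open>If \<open>\<phi>\<close> is stationary for \<open>q\<close> in the weak sense of
  \<open>inv\<close>, the terms with \<open>h\<close> integrate to zero. The infimum over
  \<open>h\<close> is then an infimum of a constant, the integral of the drift and entropy part
  \<open>G\<close>.\<close>

lemma Gamma_ge:
  assumes q: "transition_fn M q" and phi: "prob_density M \<phi>"
    and G: "G = (\<lambda>\<omega>. (\<Sum>e\<in>U. ip l e * q \<omega> e - (if q \<omega> e = 0 then 0 else q \<omega> e * ln (q \<omega> e / p \<omega> e))) * \<phi> \<omega>)"
    and int: "integrable M G"
    and inv: "\<And>h. bounded_measurable M h \<Longrightarrow> (\<integral>\<omega>. (\<Sum>e\<in>U. q \<omega> e * grad h \<omega> e) * \<phi> \<omega> \<partial>M) = 0"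
  shows "ereal (\<integral>\<omega>. G \<omega> \<partial>M) \<le> Gamma M T p l"
  unfolding Gamma_def
proof (rule SUP_upper2[of "(q, \<phi>)"])
  show "ereal (\<integral>\<omega>. G \<omega> \<partial>M)
    \<le> (INF h\<in>{h. bounded_measurable M h}. ext_integral M (Gamma_integrand T p l (fst (q, \<phi>)) (snd (q, \<phi>)) h))"
  proof (rule INF_greatest)
    fix h assume "h \<in> {h. bounded_measurable M h}"
    then have h: "bounded_measurable M h" by simp
    have [measurable]: "h \<in> borel_measurable M" using h by (rule bounded_measurableD)
    have [measurable]: "\<phi> \<in> borel_measurable M" using phi by (simp add: prob_density_def)
    have [measurable]: "e \<in> U \<Longrightarrow> (\<lambda>\<omega>. q \<omega> e) \<in> borel_measurable M" for e
      using q by (simp add: transition_fn_def)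
    obtain R where R: "0 \<le> R" "\<And>\<omega> e. \<omega> \<in> space M \<Longrightarrow> \<bar>grad h \<omega> e\<bar> \<le> R"
      using grad_bounded[OF h] by blast
    \<comment> \<open>The \<open>h\<close> part of the integrand. It is dominated by
      \<open>R * \<phi>\<close>, since \<open>q\<close> averages gradients bounded by
      \<open>R\<close>.\<close>
    let ?g = "\<lambda>\<omega>. (\<Sum>e\<in>U. q \<omega> e * grad h \<omega> e) * \<phi> \<omega>"
    have phi_int: "integrable M \<phi>"
      using phi by (intro integrableI_nonneg) (auto simp: prob_density_def)
    have "integrable M ?g"
    proof (rule Bochner_Integration.integrable_bound)
      show "integrable M (\<lambda>\<omega>. R * \<phi> \<omega>)" using phi_int by simp
      show "?g \<in> borel_measurable M" by measurable
      show "AE \<omega> in M. norm (?g \<omega>) \<le> norm (R * \<phi> \<omega>)"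
      proof (intro AE_I2)
        fix \<omega> assume \<omega>: "\<omega> \<in> space M"
        have "\<bar>\<Sum>e\<in>U. q \<omega> e * grad h \<omega> e\<bar> \<le> (\<Sum>e\<in>U. q \<omega> e * R)"
          using R(2)[OF \<omega>] q \<omega>
          by (intro order_trans[OF sum_abs] sum_mono)
            (auto simp: abs_mult transition_fn_def intro!: mult_left_mono)
        also have "\<dots> = R"
          using q \<omega> by (simp add: transition_fn_def flip: sum_distrib_right)
        finally show "norm (?g \<omega>) \<le> norm (R * \<phi> \<omega>)"
          using R(1) by (auto simp: abs_mult intro!: mult_right_mono)
      qed
    qed
    moreover have "Gamma_integrand T p l q \<phi> h = (\<lambda>\<omega>. G \<omega> + ?g \<omega>)"
      unfolding Gamma_integrand_def[abs_def] G grad_def distrib_right[symmetric] sum.distrib[symmetric]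
      by (intro ext arg_cong2[of _ _ _ _ "(*)"] sum.cong refl) (simp add: algebra_simps)
    ultimately show "ereal (\<integral>\<omega>. G \<omega> \<partial>M) \<le> ext_integral M (Gamma_integrand T p l (fst (q, \<phi>)) (snd (q, \<phi>)) h)"
      using int inv[OF h] by (simp add: ext_integral_integrable)
  qed
qed (use q phi in auto)

text \<open>The uniform kernel with density 1 is a witness: it is stationary because every
  \<open>T e\<close> preserves the measure, and its entropy term is integrable because
  \<open>ln p\<close> is.\<close>

lemma Gamma_neq_minf: "Gamma M T p l \<noteq> - \<infinity>"
proof -
  define u where "u = 1 / real (card U)"
  let ?q = "\<lambda>(\<omega>::'a) (e::int^'n). u"
  have "(axis undefined 1 :: int ^ 'n) \<in> U" by (rule axis_unitvecs)
  then have "0 < card U" using finite_U by (simp only: card_gt_0_iff) blast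
  then have u: "0 < u" "u \<le> 1" "real (card U) * u = 1" by (auto simp: u_def)
  define G where "G = (\<lambda>\<omega>. (\<Sum>e\<in>U. ip l e * ?q \<omega> e -
    (if ?q \<omega> e = 0 then 0 else ?q \<omega> e * ln (?q \<omega> e / p \<omega> e))) * 1)"
  have "ereal (\<integral>\<omega>. G \<omega> \<partial>M) \<le> Gamma M T p l"
  proof (rule Gamma_ge[OF _ _ G_def])
    show "transition_fn M ?q" using u by (simp add: transition_fn_def)
    show "prob_density M (\<lambda>_. 1)" by (simp add: prob_density_def emeasure_space_1)
    have "integrable M (\<lambda>\<omega>. \<Sum>e\<in>U. ip l e * u - u * (ln u - ln (p \<omega> e)))"
      using Lr_integrable[OF ln_p] r_gt_1 by auto
    moreover have "AE \<omega> in M. (\<Sum>e\<in>U. ip l e * u - u * (ln u - ln (p \<omega> e))) = G \<omega>"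
      using AE_p_pos
    proof eventually_elim
      case (elim \<omega>)
      then show ?case
        using u(1) unfolding G_def mult_1_right by (intro sum.cong refl) (force simp: ln_div)
    qed
    moreover have "G \<in> borel_measurable M" unfolding G_def by measurable
    ultimately show "integrable M G" using integrable_cong_AE_imp by blast
    show "(\<integral>\<omega>. (\<Sum>e\<in>U. u * grad h \<omega> e) * 1 \<partial>M) = 0" if "bounded_measurable M h" for h
      using integral_grad[OF that] by simp
  qed
  then show ?thesis by auto
qed

end

section \<open>Minimising sequences for the excess\<close>

text \<open>A crude Young inequality, obtained by replacing both factors with their maximum. It
  provides integrable majorants for products of a weight of order \<open>r - 1\<close> with a
  gradient.\<close>

lemma powr_times_le:
  fixes x y r :: real
  assumes "1 < r" "0 \<le> x" "0 \<le> y"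
  shows "x powr (r - 1) * y \<le> x powr r + y powr r"
proof -
  define m where "m = max x y"
  have m: "0 \<le> m" "x \<le> m" "y \<le> m" using assms by (auto simp: m_def)
  have "x powr (r - 1) * y \<le> m powr (r - 1) * m"
    using assms m by (intro mult_mono powr_mono2) auto
  also have "\<dots> = m powr r"
    using m by (cases "m = 0") (auto simp: powr_diff)
  also have "\<dots> \<le> x powr r + y powr r"
    by (auto simp: m_def max_def)
  finally show ?thesis .
qed

locale excess_problem = random_environment M T p l r
  for M :: "'a measure" and T :: "int ^ 'n::finite \<Rightarrow> 'a \<Rightarrow> 'a" and p :: "'a \<Rightarrow> int ^ 'n \<Rightarrow> real"
    and l :: "real ^ 'n" and r :: real +
  fixes c :: real
begin

section \<open>The excess over the level \<open>c\<close> and its cost\<close>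

definition excess :: "('a \<Rightarrow> int ^ 'n \<Rightarrow> real) \<Rightarrow> 'a \<Rightarrow> real" where
  "excess x \<omega> = max 0 (Phi x \<omega> - c)"

definition cost :: "('a \<Rightarrow> real) \<Rightarrow> real" where
  "cost h = (\<integral>\<omega>. excess (grad h) \<omega> powr r \<partial>M)"

definition inf_cost :: real where
  "inf_cost = Inf (cost ` {h. bounded_measurable M h})"

text \<open>Everything besides the excess that enters the upper bound on a component from
  \<open>component_le_Phi\<close>, summed over \<open>e\<close> to be uniform in the
  direction.\<close>

definition env_bound :: "'a \<Rightarrow> real" where
  "env_bound \<omega> = \<bar>c\<bar> + (\<Sum>e\<in>U. \<bar>ip l e\<bar> + \<bar>ln (p \<omega> e)\<bar>)"

text \<open>The terms at \<open>\<omega>\<close> bound gradients from above; the translated terms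
  bound them from below, through the reversed edge at \<open>T e \<omega>\<close>.\<close>

definition grad_dom :: "('a \<Rightarrow> real) \<Rightarrow> 'a \<Rightarrow> real" where
  "grad_dom A \<omega> = A \<omega> + env_bound \<omega> + (\<Sum>e\<in>U. A (T e \<omega>) + env_bound (T e \<omega>))"

lemma excess_nonneg: "0 \<le> excess x \<omega>"
  by (simp add: excess_def)

lemma excess_measurable:
  assumes "\<And>e. e \<in> U \<Longrightarrow> (\<lambda>\<omega>. x \<omega> e) \<in> borel_measurable M"
  shows "excess x \<in> borel_measurable M"
  using Phi_measurable[OF assms] unfolding excess_def[abs_def] by auto

lemma excess_grad_measurable[measurable]:
  "h \<in> borel_measurable M \<Longrightarrow> excess (grad h) \<in> borel_measurable M"
  by (rule excess_measurable) (rule grad_measurable)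

lemma excess_midpoint:
  assumes "\<omega> \<in> space M"
  shows "excess (\<lambda>\<omega> e. (x \<omega> e + y \<omega> e) / 2) \<omega> \<le> (excess x \<omega> + excess y \<omega>) / 2"
  using Phi_midpoint[OF assms, of x y] unfolding excess_def by (auto simp: max_def field_simps)

lemma excess_shift_le:
  assumes "\<omega> \<in> space M" "\<And>e. e \<in> U \<Longrightarrow> \<bar>x \<omega> e - y \<omega> e\<bar> \<le> R" "0 \<le> R"
  shows "excess x \<omega> \<le> excess y \<omega> + R"
proof -
  have "Phi x \<omega> \<le> Phi y \<omega> + R" using assms by (intro Phi_shift_le)
  then show ?thesis using assms(3) unfolding excess_def by auto
qed

lemma excess_grad_bounded:
  assumes "bounded_measurable M h"
  obtains K where "\<And>\<omega>. \<omega> \<in> space M \<Longrightarrow> excess (grad h) \<omega> \<le> K"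
proof -
  obtain R where R: "\<And>\<omega> e. \<omega> \<in> space M \<Longrightarrow> \<bar>grad h \<omega> e\<bar> \<le> R" using grad_bounded[OF assms] by metis
  define K where "K = R + (\<Sum>e\<in>U. \<bar>ip l e\<bar>)"
  have "excess (grad h) \<omega> \<le> \<bar>K - c\<bar>" if \<omega>: "\<omega> \<in> space M" for \<omega>
  proof -
    have "\<bar>ip l e + grad h \<omega> e - 0\<bar> \<le> K" if "e \<in> U" for e
      using member_le_sum[OF that, of "\<lambda>e. \<bar>ip l e\<bar>"] finite_U R[OF \<omega>, of e] unfolding K_def by auto
    \<comment> \<open>Comparison with the zero vector, where \<open>lse\<close> vanishes because the
      weights sum to 1.\<close>
    then have "Phi (grad h) \<omega> \<le> lse U (p \<omega>) (\<lambda>_. 0) + K"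
      unfolding Phi_def by (intro prob_weights.lse_shift_le[OF weights[OF \<omega>]])
    then show ?thesis
      using prob_weights.lse_zero[OF weights[OF \<omega>]] by (auto simp: excess_def)
  qed
  then show ?thesis by (rule that)
qed

lemma cost_integrable:
  assumes "bounded_measurable M h"
  shows "integrable M (\<lambda>\<omega>. excess (grad h) \<omega> powr r)"
proof -
  have [measurable]: "h \<in> borel_measurable M" using assms by (rule bounded_measurableD)
  obtain K where K: "\<And>\<omega>. \<omega> \<in> space M \<Longrightarrow> excess (grad h) \<omega> \<le> K"
    using excess_grad_bounded[OF assms] by metis
  then have "AE \<omega> in M. norm (excess (grad h) \<omega> powr r) \<le> K powr r"
    using r_gt_1 excess_nonneg by (auto intro!: AE_I2 powr_mono2)
  then show ?thesis
    by (rule integrable_const_bound) measurable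
qed

lemma cost_nonneg: "0 \<le> cost h"
  unfolding cost_def by (rule Bochner_Integration.integral_nonneg) simp

lemma inf_cost_le: "bounded_measurable M h \<Longrightarrow> inf_cost \<le> cost h"
  unfolding inf_cost_def by (rule cInf_lower) (auto intro!: bdd_belowI[of _ 0] cost_nonneg)

lemma near_inf_cost:
  assumes "0 < \<delta>"
  obtains h where "bounded_measurable M h" "cost h \<le> inf_cost + \<delta>"
proof -
  have "bounded_measurable M (\<lambda>_. 0)" by (auto simp: bounded_measurable_def)
  then have "cost ` {h. bounded_measurable M h} \<noteq> {}" by blast
  then show ?thesis
    using cInf_lessD[of "cost ` {h. bounded_measurable M h}" "inf_cost + \<delta>"] assms that
    unfolding inf_cost_def by (auto intro: less_imp_le)
qed

lemma inf_cost_nonneg: "0 \<le> inf_cost"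
proof (rule field_le_epsilon)
  fix \<delta> :: real assume "0 < \<delta>"
  then show "0 \<le> inf_cost + \<delta>" using near_inf_cost cost_nonneg by (metis order_trans)
qed

text \<open>The integral of the \<open>r\<close>-th power of the averaged excesses lies between the
  cost of the midpoint, by convexity of \<open>excess\<close>, and the average cost, by convexity of
  \<open>t powr r\<close>. The midpoint is itself admissible, whence the bound by
  \<open>inf_cost\<close>.\<close>

lemma cost_gap:
  assumes h: "bounded_measurable M h" and g: "bounded_measurable M g"
  shows "(\<integral>\<omega>. ((excess (grad h) \<omega> + excess (grad g) \<omega>) / 2) powr r \<partial>M) \<ge> inf_cost"
    and "integrable M (\<lambda>\<omega>. ((excess (grad h) \<omega> + excess (grad g) \<omega>) / 2) powr r)"
    and "cost (\<lambda>\<omega>. (h \<omega> + g \<omega>) / 2) \<le> (cost h + cost g) / 2"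
proof -
  have [measurable]: "h \<in> borel_measurable M" "g \<in> borel_measurable M"
    using h g by (auto dest: bounded_measurableD)
  let ?avg = "\<lambda>\<omega>. ((excess (grad h) \<omega> + excess (grad g) \<omega>) / 2) powr r"
  let ?m = "\<lambda>\<omega>. (h \<omega> + g \<omega>) / 2"
  let ?s = "\<lambda>\<omega>. (excess (grad h) \<omega> powr r + excess (grad g) \<omega> powr r) / 2"
  have ints: "integrable M ?s" using cost_integrable h g by simp
  have as: "?avg \<omega> \<le> ?s \<omega>" for \<omega>
    using r_gt_1 excess_nonneg by (intro powr_midpoint) auto
  show inta: "integrable M ?avg"
    by (rule Bochner_Integration.integrable_bound[OF ints]) (use as in \<open>auto simp: excess_nonneg\<close>)
  have m: "bounded_measurable M ?m" using h g by (rule bounded_measurable_midpoint)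
  have "inf_cost \<le> cost ?m" using m by (rule inf_cost_le)
  also have ma: "cost ?m \<le> (\<integral>\<omega>. ?avg \<omega> \<partial>M)"
    unfolding cost_def
  proof (rule integral_mono[OF cost_integrable[OF m] inta])
    fix \<omega> assume "\<omega> \<in> space M"
    then show "excess (grad ?m) \<omega> powr r \<le> ?avg \<omega>"
      unfolding grad_midpoint using r_gt_1 excess_nonneg by (intro powr_mono2 excess_midpoint) auto
  qed
  finally show "(\<integral>\<omega>. ?avg \<omega> \<partial>M) \<ge> inf_cost" .
  have "(\<integral>\<omega>. ?avg \<omega> \<partial>M) \<le> (\<integral>\<omega>. ?s \<omega> \<partial>M)"
    using ints inta as by (intro integral_mono) auto
  also have "\<dots> = (cost h + cost g) / 2"
    unfolding cost_def using cost_integrable h g by simp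
  finally show "cost ?m \<le> (cost h + cost g) / 2" using ma by simp
qed

text \<open>The midpoint of two near-minimisers costs at least \<open>inf_cost\<close>, so the convexity gap of
  \<open>t powr r\<close> between their excesses has small integral.\<close>

lemma near_minimizers_L1_close:
  assumes "0 < \<beta>"
  shows "\<exists>\<delta>>0. \<forall>h g. bounded_measurable M h \<longrightarrow> bounded_measurable M g \<longrightarrow>
    cost h \<le> inf_cost + \<delta> \<longrightarrow> cost g \<le> inf_cost + \<delta> \<longrightarrow>
    (\<integral>\<omega>. \<bar>excess (grad h) \<omega> powr r - excess (grad g) \<omega> powr r\<bar> \<partial>M) \<le> \<beta>"
proof -
  \<comment> \<open>The two costs add up to at most \<open>2 * (inf_cost + 1)\<close> below, so this
    \<open>\<eta>\<close> spends half of \<open>\<beta>\<close> on them; the bound 1/2 keeps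
    \<open>\<eta> < 1\<close>.\<close>
  define \<eta> where "\<eta> = min (1 / 2) (\<beta> / (4 * (inf_cost + 1)))"
  have I: "0 < inf_cost + 1" using inf_cost_nonneg by linarith
  have eta: "0 < \<eta>" "\<eta> < 1" using assms I by (auto simp: \<eta>_def)
  have "\<eta> * (4 * (inf_cost + 1)) \<le> \<beta> / (4 * (inf_cost + 1)) * (4 * (inf_cost + 1))"
    using I by (intro mult_right_mono) (auto simp: \<eta>_def)
  also have "\<dots> = \<beta>" using I by simp
  finally have eta_le: "\<eta> * (2 * (inf_cost + 1)) \<le> \<beta> / 2" using I by (simp add: algebra_simps)
  obtain C where C: "0 < C" "\<And>u v. \<lbrakk>0 \<le> u; 0 \<le> v\<rbrakk> \<Longrightarrow> \<bar>u powr r - v powr r\<bar> \<le>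
    \<eta> * (u powr r + v powr r) + C * ((u powr r + v powr r) / 2 - ((u + v) / 2) powr r)"
    using powr_midpoint_gap[OF r_gt_1 eta] by blast
  \<comment> \<open>The bound 1 controls the costs; the other bound makes \<open>C\<close> times the
    convexity gap at most the second half of \<open>\<beta>\<close>.\<close>
  define \<delta> where "\<delta> = min 1 (\<beta> / (2 * C))"
  have d: "0 < \<delta>" using assms C by (auto simp: \<delta>_def)
  have Cd: "C * \<delta> \<le> \<beta> / 2"
    using mult_left_mono[of \<delta> "\<beta> / (2 * C)" C] C by (simp add: \<delta>_def)
  show ?thesis
  proof (intro exI[of _ \<delta>] conjI allI impI d)
    fix h g assume "bounded_measurable M h" "bounded_measurable M g"
      "cost h \<le> inf_cost + \<delta>" "cost g \<le> inf_cost + \<delta>"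
    then have h: "bounded_measurable M h" "cost h \<le> inf_cost + \<delta>"
      and g: "bounded_measurable M g" "cost g \<le> inf_cost + \<delta>" by auto
    let ?u = "\<lambda>\<omega>. excess (grad h) \<omega>" and ?v = "\<lambda>\<omega>. excess (grad g) \<omega>"
    have "(\<integral>\<omega>. \<bar>?u \<omega> powr r - ?v \<omega> powr r\<bar> \<partial>M) \<le>
      (\<integral>\<omega>. \<eta> * (?u \<omega> powr r + ?v \<omega> powr r) +
        C * ((?u \<omega> powr r + ?v \<omega> powr r) / 2 - ((?u \<omega> + ?v \<omega>) / 2) powr r) \<partial>M)"
      using cost_integrable[OF h(1)] cost_integrable[OF g(1)] cost_gap(2)[OF h(1) g(1)]
      by (intro integral_mono C(2) excess_nonneg) auto
    also have "\<dots> = \<eta> * (cost h + cost g) + C * ((cost h + cost g) / 2 -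
      (\<integral>\<omega>. ((?u \<omega> + ?v \<omega>) / 2) powr r \<partial>M))"
      using cost_integrable[OF h(1)] cost_integrable[OF g(1)] cost_gap(2)[OF h(1) g(1)]
      by (simp add: cost_def)
    also have "\<dots> \<le> \<eta> * (2 * (inf_cost + 1)) + C * \<delta>"
    proof -
      have "\<delta> \<le> 1" by (simp add: \<delta>_def)
      then have "cost h + cost g \<le> 2 * (inf_cost + 1)" using h(2) g(2) by argo
      moreover have "(cost h + cost g) / 2 - (\<integral>\<omega>. ((?u \<omega> + ?v \<omega>) / 2) powr r \<partial>M) \<le> \<delta>"
        using cost_gap(1)[OF h(1) g(1)] h g by (simp add: field_simps)
      ultimately show ?thesis using eta C by (intro add_mono mult_left_mono) auto
    qed
    also have "\<dots> \<le> \<beta>" using Cd eta_le by linarith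
    finally show "(\<integral>\<omega>. \<bar>?u \<omega> powr r - ?v \<omega> powr r\<bar> \<partial>M) \<le> \<beta>" .
  qed
qed

section \<open>Dominated and convergent minimising sequences\<close>

text \<open>Near-minimisers approaching \<open>inf_cost\<close> fast enough have \<open>r\<close>-th
  powers of excesses that are rapidly Cauchy in L1, hence have a common integrable majorant
  \<open>V\<close>. Its \<open>r\<close>-th root is \<open>A\<close>.\<close>

lemma dominated_near_minimizers:
  obtains A where "Lr M r A" "\<And>\<omega>. 0 \<le> A \<omega>"
    "\<And>n. \<exists>h. bounded_measurable M h \<and> cost h \<le> inf_cost + (1 / real (Suc n))\<^sup>2 \<and>
      (AE \<omega> in M. excess (grad h) \<omega> \<le> A \<omega>)"
proof -
  define close where "close \<beta> \<delta> \<longleftrightarrow> (\<forall>h g. bounded_measurable M h \<longrightarrow> bounded_measurable M g \<longrightarrow>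
      cost h \<le> inf_cost + \<delta> \<longrightarrow> cost g \<le> inf_cost + \<delta> \<longrightarrow>
      (\<integral>\<omega>. \<bar>excess (grad h) \<omega> powr r - excess (grad g) \<omega> powr r\<bar> \<partial>M) \<le> \<beta>)" for \<beta> \<delta>
  have "\<exists>\<delta>>0. close ((1 / 2) ^ k) \<delta>" for k :: nat
    unfolding close_def by (rule near_minimizers_L1_close) simp
  then obtain \<delta> where \<delta>: "\<And>k. 0 < \<delta> k" "\<And>k. close ((1 / 2) ^ k) (\<delta> k)"
    by metis
  \<comment> \<open>A running minimum, so that \<open>x (Suc k)\<close> also meets the threshold
    \<open>\<delta> k\<close> and the pair is close. The squares are the rate claimed for the
    cost.\<close>
  define \<eta> where "\<eta> k = Min ((\<lambda>j. min (\<delta> j) ((1 / real (Suc j))\<^sup>2)) ` {..k})" for k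
  have eta_pos: "0 < \<eta> k" for k
    unfolding \<eta>_def by (subst Min_gr_iff) (auto simp: \<delta>(1))
  have eta_le: "\<eta> k \<le> min (\<delta> j) ((1 / real (Suc j))\<^sup>2)" if "j \<le> k" for j k
    unfolding \<eta>_def using that by (intro Min_le) auto
  have "\<exists>h. bounded_measurable M h \<and> cost h \<le> inf_cost + \<eta> k" for k
    using near_inf_cost[OF eta_pos] by blast
  then obtain x where x: "\<And>k. bounded_measurable M (x k)" "\<And>k. cost (x k) \<le> inf_cost + \<eta> k"
    by metis
  let ?u = "\<lambda>k \<omega>. excess (grad (x k)) \<omega> powr r"
  obtain V where V: "integrable M V" "AE \<omega> in M. (\<forall>n. \<bar>?u n \<omega>\<bar> \<le> V \<omega>) \<and> convergent (\<lambda>n. ?u n \<omega>)"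
  proof (rule fast_L1_Cauchy[of M ?u])
    show "integrable M (?u k)" for k using cost_integrable[OF x(1)] .
    show "(\<integral>\<omega>. \<bar>?u (Suc k) \<omega> - ?u k \<omega>\<bar> \<partial>M) \<le> (1 / 2) ^ k" for k
      using x(2)[of k] x(2)[of "Suc k"] eta_le[of k k] eta_le[of k "Suc k"]
      by (intro \<delta>(2)[unfolded close_def, rule_format] x(1)) auto
  qed
  define A where "A \<omega> = \<bar>V \<omega>\<bar> powr (1 / r)" for \<omega>
  show ?thesis
  proof (rule that[of A])
    have [measurable]: "V \<in> borel_measurable M" using V by auto
    show "Lr M r A"
      using V(1) r_gt_1 unfolding Lr_def A_def by (auto simp: powr_powr)
    show "0 \<le> A \<omega>" for \<omega> by (simp add: A_def)
    fix n
    have "AE \<omega> in M. excess (grad (x n)) \<omega> \<le> A \<omega>"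
      using V(2)
    proof eventually_elim
      case (elim \<omega>)
      have "excess (grad (x n)) \<omega> = ?u n \<omega> powr (1 / r)"
        using r_gt_1 excess_nonneg by (simp add: powr_powr)
      also have "\<dots> \<le> A \<omega>"
      proof -
        have "?u n \<omega> \<le> \<bar>V \<omega>\<bar>" using elim by (metis abs_ge_self order_trans)
        then show ?thesis unfolding A_def using r_gt_1 by (intro powr_mono2) auto
      qed
      finally show ?case .
    qed
    then show "\<exists>h. bounded_measurable M h \<and> cost h \<le> inf_cost + (1 / real (Suc n))\<^sup>2 \<and>
      (AE \<omega> in M. excess (grad h) \<omega> \<le> A \<omega>)"
      using x[of n] eta_le[of n n] by (intro exI[of _ "x n"]) auto
  qed
qed

lemma env_bound_nonneg: "0 \<le> env_bound \<omega>"
  unfolding env_bound_def by (intro add_nonneg_nonneg sum_nonneg) auto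

lemma Lr_env_bound: "Lr M r env_bound"
  unfolding env_bound_def[abs_def] using r_gt_1
  by (intro Lr_add Lr_sum Lr_const Lr_abs ln_p) auto

lemma Lr_grad_dom:
  assumes "Lr M r A"
  shows "Lr M r (grad_dom A)"
  unfolding grad_dom_def[abs_def] using r_gt_1
  by (intro Lr_add Lr_sum Lr_env_bound assms measure_preserving_Lr[OF T_preserving]) auto

lemma grad_le_grad_dom:
  assumes A: "\<And>\<omega>. 0 \<le> A \<omega>" and ae: "AE \<omega> in M. excess (grad h) \<omega> \<le> A \<omega>"
  shows "AE \<omega> in M. \<forall>e\<in>U. \<bar>grad h \<omega> e\<bar> \<le> grad_dom A \<omega>"
proof -
  define good where "good \<omega> \<longleftrightarrow> (\<forall>e\<in>U. grad h \<omega> e \<le> A \<omega> + env_bound \<omega>)" for \<omega>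
  have good: "AE \<omega> in M. good \<omega>"
    using ae AE_p_pos AE_space
  proof eventually_elim
    case (elim \<omega>)
    show ?case unfolding good_def
    proof
      fix e assume e: "e \<in> U"
      have "Phi (grad h) \<omega> \<le> A \<omega> + \<bar>c\<bar>" using elim(1) by (auto simp: excess_def)
      moreover have "\<bar>ip l e\<bar> + \<bar>ln (p \<omega> e)\<bar> \<le> (\<Sum>e\<in>U. \<bar>ip l e\<bar> + \<bar>ln (p \<omega> e)\<bar>)"
        using e finite_U by (intro member_le_sum) auto
      moreover have "ip l e + grad h \<omega> e \<le> Phi (grad h) \<omega> - ln (p \<omega> e)"
        using elim e by (intro component_le_Phi) auto
      ultimately show "grad h \<omega> e \<le> A \<omega> + env_bound \<omega>"
        unfolding env_bound_def by linarith
    qed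
  qed
  \<comment> \<open>Measure preservation carries the upper bound to all neighbours, where it is read
    along the reversed edges.\<close>
  have "AE \<omega> in M. \<forall>e\<in>U. good (T e \<omega>)"
    using good finite_U by (simp add: AE_finite_all AE_T)
  with good AE_space show ?thesis
  proof eventually_elim
    case (elim \<omega>)
    let ?s = "\<lambda>e. A (T e \<omega>) + env_bound (T e \<omega>)"
    have nn: "0 \<le> ?s e" for e using A env_bound_nonneg by (simp add: add_nonneg_nonneg)
    show ?case
    proof
      fix e assume e: "e \<in> U"
      have "- grad h \<omega> e \<le> ?s e"
        using elim e grad_reverse[of \<omega> h e] uminus_unitvecs[OF e] unfolding good_def by metis
      moreover have "grad h \<omega> e \<le> A \<omega> + env_bound \<omega>" using elim e by (simp add: good_def)
      moreover have "?s e \<le> sum ?s U" using e finite_U nn by (intro member_le_sum) auto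
      ultimately show "\<bar>grad h \<omega> e\<bar> \<le> grad_dom A \<omega>"
        using A[of \<omega>] env_bound_nonneg[of \<omega>] nn[of e] unfolding grad_dom_def by linarith
    qed
  qed
qed

lemma grad_dom_nonneg: "(\<And>\<omega>. 0 \<le> A \<omega>) \<Longrightarrow> 0 \<le> grad_dom A \<omega>"
  unfolding grad_dom_def using env_bound_nonneg by (auto intro!: add_nonneg_nonneg sum_nonneg)

text \<open>The sets \<open>S n\<close> below are closed under midpoints; this takes the place of weak compactness and
  Mazur's lemma, for the weighted norm \<open>N\<close> is almost minimised along a Cauchy sequence.\<close>

lemma convergent_near_minimizers:
  obtains A y where "Lr M r A" "\<And>\<omega>. 0 \<le> A \<omega>"
    "\<And>n. bounded_measurable M (y n)" "\<And>n. cost (y n) \<le> inf_cost + (1 / real (Suc n))\<^sup>2"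
    "\<And>n. AE \<omega> in M. excess (grad (y n)) \<omega> \<le> A \<omega>"
    "AE \<omega> in M. \<forall>e\<in>U. convergent (\<lambda>n. grad (y n) \<omega> e)"
proof -
  obtain A where A: "Lr M r A" "\<And>\<omega>. 0 \<le> A \<omega>"
    "\<And>n. \<exists>h. bounded_measurable M h \<and> cost h \<le> inf_cost + (1 / real (Suc n))\<^sup>2 \<and>
      (AE \<omega> in M. excess (grad h) \<omega> \<le> A \<omega>)"
    using dominated_near_minimizers by metis
  define S where "S n = {h. bounded_measurable M h \<and> cost h \<le> inf_cost + (1 / real (Suc n))\<^sup>2 \<and>
      (AE \<omega> in M. excess (grad h) \<omega> \<le> A \<omega>)}" for n
  \<comment> \<open>Gradients are dominated only in the space with exponent \<open>r\<close>, and
    \<open>r\<close> may be below 2. With this weight they are bounded by 1, so their squares are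
    integrable.\<close>
  define w where "w \<omega> = 1 / (1 + grad_dom A \<omega>)" for \<omega>
  have wpos: "0 < w \<omega>" for \<omega>
    using grad_dom_nonneg[of A \<omega>] A(2) by (simp add: w_def add_pos_nonneg)
  have [measurable]: "grad_dom A \<in> borel_measurable M"
    using Lr_grad_dom[OF A(1)] by (rule Lr_measurable)
  have [measurable]: "w \<in> borel_measurable M"
    unfolding w_def[abs_def] by measurable
  have S_dec: "S n \<subseteq> S m" if "m \<le> n" for m n
  proof -
    have "(1 / real (Suc n))\<^sup>2 \<le> (1 / real (Suc m))\<^sup>2"
      using that by (intro power_mono) (auto simp: field_simps)
    then show ?thesis unfolding S_def by (blast intro: order_trans add_left_mono)
  qed
  have S_mid: "(\<lambda>\<omega>. (h \<omega> + g \<omega>) / 2) \<in> S n" if "h \<in> S n" "g \<in> S n" for h g n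
  proof -
    have hg: "bounded_measurable M h" "bounded_measurable M g" using that by (auto simp: S_def)
    have "AE \<omega> in M. excess (grad h) \<omega> \<le> A \<omega>" "AE \<omega> in M. excess (grad g) \<omega> \<le> A \<omega>"
      using that by (auto simp: S_def)
    then have "AE \<omega> in M. excess (grad (\<lambda>\<omega>. (h \<omega> + g \<omega>) / 2)) \<omega> \<le> A \<omega>"
      using AE_space
    proof eventually_elim
      case (elim \<omega>)
      then show ?case unfolding grad_midpoint
        using excess_midpoint[of \<omega> "grad h" "grad g"] by argo
    qed
    moreover have "cost (\<lambda>\<omega>. (h \<omega> + g \<omega>) / 2) \<le> inf_cost + (1 / real (Suc n))\<^sup>2"
    proof -
      have "cost h \<le> inf_cost + (1 / real (Suc n))\<^sup>2" "cost g \<le> inf_cost + (1 / real (Suc n))\<^sup>2"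
        using that by (auto simp only: S_def)
      then show ?thesis using cost_gap(3)[OF hg] by argo
    qed
    ultimately show ?thesis using bounded_measurable_midpoint[OF hg] by (simp add: S_def)
  qed
  define N where "N h = (\<integral>\<omega>. (\<Sum>e\<in>U. (w \<omega> * grad h \<omega> e)\<^sup>2) \<partial>M)" for h
  have S_meas: "h \<in> borel_measurable M" if "h \<in> S n" for h n
    using that by (simp add: S_def bounded_measurableD)
  have wg: "AE \<omega> in M. \<forall>e\<in>U. \<bar>w \<omega> * grad h \<omega> e\<bar> \<le> 1" if "h \<in> S n" for h n
  proof -
    have "AE \<omega> in M. \<forall>e\<in>U. \<bar>grad h \<omega> e\<bar> \<le> grad_dom A \<omega>"
      using that A(2) by (intro grad_le_grad_dom) (auto simp: S_def)
    then show ?thesis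
    proof eventually_elim
      case (elim \<omega>)
      show ?case
      proof
        fix e assume "e \<in> U"
        then have "\<bar>grad h \<omega> e\<bar> \<le> 1 + grad_dom A \<omega>" using elim by force
        then show "\<bar>w \<omega> * grad h \<omega> e\<bar> \<le> 1"
          using grad_dom_nonneg[of A \<omega>] A(2) by (simp add: w_def abs_mult)
      qed
    qed
  qed
  have wg_int: "integrable M (\<lambda>\<omega>. w \<omega> * grad h \<omega> e)" if "h \<in> S n" "e \<in> U" for h n e
  proof (rule integrable_const_bound)
    show "AE \<omega> in M. norm (w \<omega> * grad h \<omega> e) \<le> 1"
      using wg[OF that(1)] by eventually_elim (use that in auto)
    have [measurable]: "h \<in> borel_measurable M" using that S_meas by blast
    show "(\<lambda>\<omega>. w \<omega> * grad h \<omega> e) \<in> borel_measurable M" by measurable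
  qed
  have sq_int: "integrable M (\<lambda>\<omega>. \<Sum>e\<in>U. (w \<omega> * grad h \<omega> e)\<^sup>2)" and N_le: "N h \<le> real (card U)"
    if "h \<in> S n" for h n
  proof -
    have [measurable]: "h \<in> borel_measurable M" using that S_meas by blast
    have le: "AE \<omega> in M. (\<Sum>e\<in>U. (w \<omega> * grad h \<omega> e)\<^sup>2) \<le> real (card U)"
      using wg[OF that]
    proof eventually_elim
      case (elim \<omega>)
      then have "(\<Sum>e\<in>U. (w \<omega> * grad h \<omega> e)\<^sup>2) \<le> (\<Sum>e\<in>U. 1)"
        by (intro sum_mono) (auto simp: abs_square_le_1)
      then show ?case by simp
    qed
    show int: "integrable M (\<lambda>\<omega>. \<Sum>e\<in>U. (w \<omega> * grad h \<omega> e)\<^sup>2)"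
      by (rule integrable_const_bound[of _ "real (card U)"]) (use le in \<open>auto simp: sum_nonneg\<close>)
    have "N h \<le> (\<integral>\<omega>. real (card U) \<partial>M)"
      unfolding N_def using int le by (intro integral_mono_AE) auto
    then show "N h \<le> real (card U)" by (simp add: prob_space)
  qed
  obtain \<rho> :: "nat \<Rightarrow> nat" and y where y: "mono \<rho>" "\<And>k. k \<le> \<rho> k" "\<And>k. y k \<in> S (\<rho> k)"
    "\<And>k z. z \<in> S (\<rho> k) \<Longrightarrow> N (y k) \<le> N z + (1 / 4) ^ Suc k \<and> N (y (Suc k)) \<le> N z + (1 / 4) ^ Suc k"
  \<comment> \<open>The tolerance is chosen with the parallelogram law in view: four times
    \<open>(1 / 4) ^ Suc k\<close> is \<open>(1 / 4) ^ k\<close>.\<close>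
  proof (rule near_minimizers[of S N "real (card U)" "\<lambda>k. (1 / 4) ^ Suc k"])
    show "S n \<noteq> {}" for n using A(3)[of n] by (auto simp: S_def)
    show "0 \<le> N x \<and> N x \<le> real (card U)" if "x \<in> S 0" for x
      using N_le[OF that] by (auto simp: N_def intro!: Bochner_Integration.integral_nonneg sum_nonneg)
    show "decseq (\<lambda>k. (1 / 4 :: real) ^ Suc k)"
      by (intro decseq_SucI) (simp add: field_simps)
  qed (use S_dec in auto)
  have y_S: "y k \<in> S k" for k using y(2,3) S_dec by blast
  have fast: "(\<integral>\<omega>. \<bar>w \<omega> * grad (y (Suc k)) \<omega> e - w \<omega> * grad (y k) \<omega> e\<bar> \<partial>M) \<le> (1 / 2) ^ k"
    if e: "e \<in> U" for k e
  proof -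
    let ?a = "\<lambda>\<omega> e. w \<omega> * grad (y (Suc k)) \<omega> e" and ?b = "\<lambda>\<omega> e. w \<omega> * grad (y k) \<omega> e"
    define m where "m = (\<lambda>\<omega>. (y k \<omega> + y (Suc k) \<omega>) / 2)"
    \<comment> \<open>Both neighbours lie in the same set \<open>S (\<rho> k)\<close>, so their
      midpoint \<open>m\<close> is a legitimate competitor there.\<close>
    have "y (Suc k) \<in> S (\<rho> k)" using y(3)[of "Suc k"] S_dec[of "\<rho> k" "\<rho> (Suc k)"] monoD[OF y(1), of k "Suc k"] by auto
    then have mS: "m \<in> S (\<rho> k)" unfolding m_def using y(3) by (intro S_mid) auto
    note ints = sq_int[OF y(3)[of k]] sq_int[OF y(3)[of "Suc k"]] sq_int[OF mS]
    have sq_id: "(v * s - v * t)\<^sup>2 = 2 * (v * s)\<^sup>2 + 2 * (v * t)\<^sup>2 - 4 * (v * ((t + s) / 2))\<^sup>2" for v s t :: real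
      by (simp add: power2_eq_square algebra_simps)
    \<comment> \<open>The parallelogram law, pointwise: near-minimality against \<open>m\<close>
      makes the squared distance small after integration.\<close>
    have par: "(\<Sum>e\<in>U. (?a \<omega> e - ?b \<omega> e)\<^sup>2) = 2 * (\<Sum>e\<in>U. (?a \<omega> e)\<^sup>2) + 2 * (\<Sum>e\<in>U. (?b \<omega> e)\<^sup>2)
      - 4 * (\<Sum>e\<in>U. (w \<omega> * grad m \<omega> e)\<^sup>2)" for \<omega>
      unfolding sum_distrib_left sum.distrib[symmetric] sum_subtractf[symmetric]
      unfolding m_def grad_midpoint by (intro sum.cong refl sq_id)
    have pint: "integrable M (\<lambda>\<omega>. \<Sum>e\<in>U. (?a \<omega> e - ?b \<omega> e)\<^sup>2)"
      unfolding par using ints by auto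
    have "(\<integral>\<omega>. (\<Sum>e\<in>U. (?a \<omega> e - ?b \<omega> e)\<^sup>2) \<partial>M) = 2 * N (y (Suc k)) + 2 * N (y k) - 4 * N m"
      unfolding par N_def using ints by simp
    also have "\<dots> \<le> (1 / 4) ^ k" using y(4)[OF mS] by simp
    finally have sq: "(\<integral>\<omega>. (\<Sum>e\<in>U. (?a \<omega> e - ?b \<omega> e)\<^sup>2) \<partial>M) \<le> (1 / 4) ^ k" .
    \<comment> \<open>From L2 to L1 on a probability space by
      \<open>2 * \<bar>v\<bar> <= 1 / x + x * v^2\<close>; the choice \<open>x = 2 ^ k\<close>
      balances the two terms.\<close>
    have "(\<integral>\<omega>. \<bar>?a \<omega> e - ?b \<omega> e\<bar> \<partial>M) \<le>
      (\<integral>\<omega>. ((1 / 2) ^ k + 2 ^ k * (\<Sum>e\<in>U. (?a \<omega> e - ?b \<omega> e)\<^sup>2)) / 2 \<partial>M)"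
    proof (rule integral_mono)
      show "integrable M (\<lambda>\<omega>. \<bar>?a \<omega> e - ?b \<omega> e\<bar>)"
        using wg_int[OF y(3) e] by (intro integrable_abs Bochner_Integration.integrable_diff) auto
      show "integrable M (\<lambda>\<omega>. ((1 / 2) ^ k + 2 ^ k * (\<Sum>e\<in>U. (?a \<omega> e - ?b \<omega> e)\<^sup>2)) / 2)"
        using pint by simp
      fix \<omega>
      define v where "v = ?a \<omega> e - ?b \<omega> e"
      have "v\<^sup>2 \<le> (\<Sum>e\<in>U. (?a \<omega> e - ?b \<omega> e)\<^sup>2)"
        unfolding v_def using e finite_U by (intro member_le_sum) auto
      then have "2 ^ k * v\<^sup>2 \<le> 2 ^ k * (\<Sum>e\<in>U. (?a \<omega> e - ?b \<omega> e)\<^sup>2)" by (intro mult_left_mono) auto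
      moreover have "2 * \<bar>v\<bar> \<le> (1 / 2) ^ k + 2 ^ k * v\<^sup>2"
      proof -
        have "2 * \<bar>v\<bar> \<le> 1 / x + x * v\<^sup>2" if "0 < x" for x :: real
          using that sum_squares_ge_zero[of "x * \<bar>v\<bar> - 1" 0]
          by (simp add: field_simps power2_eq_square)
        from this[of "2 ^ k"] show ?thesis by (simp add: power_one_over)
      qed
      ultimately show "\<bar>?a \<omega> e - ?b \<omega> e\<bar> \<le> ((1 / 2) ^ k + 2 ^ k * (\<Sum>e\<in>U. (?a \<omega> e - ?b \<omega> e)\<^sup>2)) / 2"
        unfolding v_def[symmetric] by argo
    qed
    also have "\<dots> = ((1 / 2) ^ k + 2 ^ k * (\<integral>\<omega>. (\<Sum>e\<in>U. (?a \<omega> e - ?b \<omega> e)\<^sup>2) \<partial>M)) / 2"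
      using pint by (simp add: prob_space)
    also have "\<dots> \<le> ((1 / 2) ^ k + 2 ^ k * (1 / 4) ^ k) / 2"
      using sq by (intro divide_right_mono add_left_mono mult_left_mono) auto
    also have "\<dots> = (1 / 2) ^ k"
    proof -
      have "2 ^ k * (1 / 4) ^ k = (1 / 2 :: real) ^ k"
        by (subst power_mult_distrib[symmetric]) simp
      then show ?thesis by simp
    qed
    finally show ?thesis .
  qed
  have conv: "AE \<omega> in M. convergent (\<lambda>n. grad (y n) \<omega> e)" if e: "e \<in> U" for e
  proof -
    obtain V where "AE \<omega> in M. (\<forall>n. \<bar>w \<omega> * grad (y n) \<omega> e\<bar> \<le> V \<omega>) \<and> convergent (\<lambda>n. w \<omega> * grad (y n) \<omega> e)"
      using fast_L1_Cauchy[of M "\<lambda>n \<omega>. w \<omega> * grad (y n) \<omega> e"] wg_int[OF y(3) e] fast[OF e] by blast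
    then show ?thesis
    proof eventually_elim
      case (elim \<omega>)
      \<comment> \<open>The weight does not depend on \<open>n\<close> and is strictly positive, so
        it can be divided out.\<close>
      then have "convergent (\<lambda>n. 1 / w \<omega> * (w \<omega> * grad (y n) \<omega> e))"
        using convergent_mult[OF convergent_const[of "1 / w \<omega>"]] by blast
      then show ?case using wpos[of \<omega>] by simp
    qed
  qed
  show ?thesis
  proof (rule that[of A y])
    show "AE \<omega> in M. \<forall>e\<in>U. convergent (\<lambda>n. grad (y n) \<omega> e)"
      using conv finite_U by (simp add: AE_finite_all)
  qed (use y_S A(1,2) in \<open>simp_all only: S_def mem_Collect_eq\<close>)
qed

end

section \<open>The limiting gradient\<close>

locale minimizing_sequence = excess_problem M T p l r c
  for M :: "'a measure" and T :: "int ^ 'n::finite \<Rightarrow> 'a \<Rightarrow> 'a" and p :: "'a \<Rightarrow> int ^ 'n \<Rightarrow> real"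
    and l :: "real ^ 'n" and r c :: real +
  fixes A :: "'a \<Rightarrow> real" and y :: "nat \<Rightarrow> 'a \<Rightarrow> real"
  assumes A_Lr: "Lr M r A" and A_nonneg: "\<And>\<omega>. 0 \<le> A \<omega>"
    and y_bounded: "\<And>n. bounded_measurable M (y n)"
    and y_cost: "\<And>n. cost (y n) \<le> inf_cost + (1 / real (Suc n))\<^sup>2"
    and y_excess: "\<And>n. AE \<omega> in M. excess (grad (y n)) \<omega> \<le> A \<omega>"
    and y_convergent: "AE \<omega> in M. \<forall>e\<in>U. convergent (\<lambda>n. grad (y n) \<omega> e)"
begin

text \<open>\<open>lim\<close> is total, which keeps \<open>F\<close> measurable. Its value means
  nothing where the gradients diverge; for \<open>e\<close> in \<open>U\<close> this is a null set
  by \<open>y_convergent\<close>.\<close>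

definition F :: "'a \<Rightarrow> int ^ 'n \<Rightarrow> real" where
  "F \<omega> e = lim (\<lambda>n. grad (y n) \<omega> e)"

text \<open>Up to the factor \<open>r\<close>, the derivative of \<open>t powr r\<close> at the
  limiting excess; after normalisation, the density of the competitor in
  \<open>Gamma\<close>.\<close>

definition weight :: "'a \<Rightarrow> real" where
  "weight \<omega> = excess F \<omega> powr (r - 1)"

lemma y_measurable[measurable]: "y n \<in> borel_measurable M"
  using y_bounded by (rule bounded_measurableD)

lemma A_measurable[measurable]: "A \<in> borel_measurable M"
  using A_Lr by (rule Lr_measurable)

lemma F_measurable[measurable]: "(\<lambda>\<omega>. F \<omega> e) \<in> borel_measurable M"
  unfolding F_def by measurable

lemma excess_F_measurable[measurable]: "excess F \<in> borel_measurable M"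
  by (rule excess_measurable) (rule F_measurable)

lemma weight_nonneg: "0 \<le> weight \<omega>"
  by (simp add: weight_def)

lemma weight_measurable[measurable]: "weight \<in> borel_measurable M"
  unfolding weight_def[abs_def] by measurable

lemma tilt_F_measurable[measurable]: "e \<in> U \<Longrightarrow> (\<lambda>\<omega>. tilt F \<omega> e) \<in> borel_measurable M"
  by (rule tilt_measurable) (rule F_measurable)

lemma grad_tendsto_F: "AE \<omega> in M. \<forall>e\<in>U. (\<lambda>n. grad (y n) \<omega> e) \<longlonglongrightarrow> F \<omega> e"
  using y_convergent by eventually_elim (simp add: F_def convergent_LIMSEQ_iff)

lemma grad_y_dominated: "AE \<omega> in M. \<forall>n. \<forall>e\<in>U. \<bar>grad (y n) \<omega> e\<bar> \<le> grad_dom A \<omega>"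
  unfolding AE_all_countable using grad_le_grad_dom[OF A_nonneg y_excess] by blast

lemma F_dominated: "AE \<omega> in M. \<forall>e\<in>U. \<bar>F \<omega> e\<bar> \<le> grad_dom A \<omega>"
  using grad_tendsto_F grad_y_dominated
proof eventually_elim
  case (elim \<omega>)
  show ?case
  proof
    fix e assume "e \<in> U"
    then have "(\<lambda>n. \<bar>grad (y n) \<omega> e\<bar>) \<longlonglongrightarrow> \<bar>F \<omega> e\<bar>" "\<forall>n. \<bar>grad (y n) \<omega> e\<bar> \<le> grad_dom A \<omega>"
      using elim by (auto intro: tendsto_rabs)
    then show "\<bar>F \<omega> e\<bar> \<le> grad_dom A \<omega>"
      by (intro LIMSEQ_le_const2) auto
  qed
qed

lemma excess_F_le: "AE \<omega> in M. excess F \<omega> \<le> A \<omega>"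
proof -
  have "AE \<omega> in M. \<forall>n. excess (grad (y n)) \<omega> \<le> A \<omega>"
    unfolding AE_all_countable using y_excess by blast
  then show ?thesis
    using grad_tendsto_F AE_space
  proof eventually_elim
    case (elim \<omega>)
    have "(\<lambda>n. excess (grad (y n)) \<omega>) \<longlonglongrightarrow> excess F \<omega>"
      unfolding excess_def using elim by (intro tendsto_intros tendsto_Phi) auto
    then show ?case using elim by (intro LIMSEQ_le_const2) auto
  qed
qed

lemma abs_tilt_sum_le:
  assumes "\<omega> \<in> space M" "\<And>e. e \<in> U \<Longrightarrow> \<bar>v e\<bar> \<le> R"
  shows "\<bar>\<Sum>e\<in>U. tilt x \<omega> e * v e\<bar> \<le> R"
  unfolding tilt_def using assms(2) by (rule prob_weights.abs_gibbs_sum_le[OF weights[OF assms(1)]])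

section \<open>The first-order condition at the limit\<close>

text \<open>The tangents of \<open>t powr r\<close> and of \<open>Phi\<close> are both taken at the
  perturbed point \<open>z\<close>. Convexity then bounds the increment from above with no
  second-order error.\<close>

lemma cost_increment_le:
  assumes h: "bounded_measurable M h" and g: "bounded_measurable M g" and t: "0 \<le> t"
    and z: "z = (\<lambda>\<omega>. h \<omega> + t * g \<omega>)"
    and X: "X = (\<lambda>\<omega>. excess (grad z) \<omega> powr (r - 1) * (\<Sum>e\<in>U. tilt (grad z) \<omega> e * grad g \<omega> e))"
    and int: "integrable M X"
  shows "cost z - cost h \<le> r * t * (\<integral>\<omega>. X \<omega> \<partial>M)"
proof -
  have zb: "bounded_measurable M z" unfolding z using h g by (rule bounded_measurable_add_scaled)
  have "cost z - cost h = (\<integral>\<omega>. excess (grad z) \<omega> powr r - excess (grad h) \<omega> powr r \<partial>M)"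
    unfolding cost_def using cost_integrable[OF zb] cost_integrable[OF h] by simp
  also have "\<dots> \<le> (\<integral>\<omega>. r * t * X \<omega> \<partial>M)"
  proof (rule integral_mono)
    show "integrable M (\<lambda>\<omega>. excess (grad z) \<omega> powr r - excess (grad h) \<omega> powr r)"
      using cost_integrable[OF zb] cost_integrable[OF h] by simp
    show "integrable M (\<lambda>\<omega>. r * t * X \<omega>)" using int by simp
    fix \<omega> assume \<omega>: "\<omega> \<in> space M"
    let ?a = "excess (grad z) \<omega>" and ?b = "excess (grad h) \<omega>"
    let ?s = "\<Sum>e\<in>U. tilt (grad z) \<omega> e * grad g \<omega> e"
    have "grad z \<omega> e - grad h \<omega> e = t * grad g \<omega> e" for e
      by (simp add: z grad_def algebra_simps)
    then have "Phi (grad z) \<omega> - Phi (grad h) \<omega> \<le> t * ?s"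
      using Phi_tangent[OF \<omega>, of "grad z" "grad h"] by (simp add: sum_distrib_left mult_ac)
    \<comment> \<open>The truncation at zero can break this bound where \<open>?a = 0\<close>, but
      there the factor \<open>?a powr (r - 1)\<close> vanishes.\<close>
    then have "?a - ?b \<le> t * ?s" if "?a \<noteq> 0"
      using that by (auto simp: excess_def max_def split: if_splits)
    then have "?a powr (r - 1) * (?a - ?b) \<le> ?a powr (r - 1) * (t * ?s)"
      by (cases "?a = 0") (auto intro: mult_left_mono)
    then have "r * (?a powr (r - 1) * (?a - ?b)) \<le> r * (?a powr (r - 1) * (t * ?s))"
      by (rule mult_left_mono) (use r_gt_1 in simp)
    moreover have "?a powr r - ?b powr r \<le> r * ?a powr (r - 1) * (?a - ?b)"
      using r_gt_1 excess_nonneg by (intro powr_tangent) auto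
    ultimately show "?a powr r - ?b powr r \<le> r * t * X \<omega>"
      unfolding X by (simp only: mult_ac)
  qed
  also have "\<dots> = r * t * (\<integral>\<omega>. X \<omega> \<partial>M)" by simp
  finally show ?thesis .
qed

text \<open>The step size \<open>1 / Suc n\<close> is the square root of the distance of \<open>cost (y n)\<close> from the
  infimum, so that the defect in the first-order condition is of the same order and vanishes.\<close>

lemma stationary_ge:
  assumes g: "bounded_measurable M g"
  shows "0 \<le> (\<integral>\<omega>. weight \<omega> * (\<Sum>e\<in>U. tilt F \<omega> e * grad g \<omega> e) \<partial>M)"
proof -
  have [measurable]: "g \<in> borel_measurable M" using g by (rule bounded_measurableD)
  obtain R where R: "0 \<le> R" "\<And>\<omega> e. \<omega> \<in> space M \<Longrightarrow> \<bar>grad g \<omega> e\<bar> \<le> R"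
    using grad_bounded[OF g] by metis
  define t where "t n = 1 / real (Suc n)" for n
  have t: "0 < t n" "t n \<le> 1" for n by (auto simp: t_def)
  have t_lim: "t \<longlonglongrightarrow> 0"
    unfolding t_def using LIMSEQ_inverse_real_of_nat by (simp add: inverse_eq_divide)
  define z where "z n = (\<lambda>\<omega>. y n \<omega> + t n * g \<omega>)" for n
  have zb: "bounded_measurable M (z n)" for n
    unfolding z_def using y_bounded g by (rule bounded_measurable_add_scaled)
  have [measurable]: "z n \<in> borel_measurable M" for n using zb by (rule bounded_measurableD)
  have grad_z: "grad (z n) \<omega> e = grad (y n) \<omega> e + t n * grad g \<omega> e" for n \<omega> e
    by (simp add: z_def grad_def algebra_simps)
  define X where "X n = (\<lambda>\<omega>. excess (grad (z n)) \<omega> powr (r - 1) *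
    (\<Sum>e\<in>U. tilt (grad (z n)) \<omega> e * grad g \<omega> e))" for n
  define XF where "XF \<omega> = weight \<omega> * (\<Sum>e\<in>U. tilt F \<omega> e * grad g \<omega> e)" for \<omega>
  have [measurable]: "e \<in> U \<Longrightarrow> (\<lambda>\<omega>. tilt (grad (z n)) \<omega> e) \<in> borel_measurable M" for n e
    by (rule tilt_measurable) measurable
  have X_meas: "X n \<in> borel_measurable M" for n unfolding X_def by measurable
  have XF_meas: "XF \<in> borel_measurable M" unfolding XF_def[abs_def] by measurable
  \<comment> \<open>Steps are at most 1, so the perturbed excess is at most \<open>A + R\<close>;
    the product with a gradient bounded by \<open>R\<close> is then absorbed by
    \<open>powr_times_le\<close>.\<close>
  define B where "B \<omega> = (A \<omega> + R) powr r + R powr r" for \<omega>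
  have "integrable M (\<lambda>\<omega>. \<bar>A \<omega> + R\<bar> powr r)"
    using Lr_add[OF A_Lr Lr_const] r_gt_1 by (auto simp: Lr_def)
  moreover have "\<bar>A \<omega> + R\<bar> = A \<omega> + R" for \<omega> using A_nonneg[of \<omega>] R(1) by simp
  ultimately have B_int: "integrable M B" unfolding B_def[abs_def] by simp
  have X_le: "AE \<omega> in M. norm (X n \<omega>) \<le> B \<omega>" for n
    using y_excess[of n] AE_space
  proof eventually_elim
    case (elim \<omega>)
    have "t n * \<bar>grad g \<omega> e\<bar> \<le> 1 * R" for e
      using t[of n] R elim by (intro mult_mono) auto
    then have "excess (grad (z n)) \<omega> \<le> excess (grad (y n)) \<omega> + R"
      using t[of n] R elim by (intro excess_shift_le) (auto simp: grad_z abs_mult)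
    then have "excess (grad (z n)) \<omega> \<le> A \<omega> + R" using elim by auto
    then have "\<bar>X n \<omega>\<bar> \<le> (A \<omega> + R) powr (r - 1) * R"
      unfolding X_def abs_mult using elim R r_gt_1 excess_nonneg
      by (intro mult_mono abs_tilt_sum_le) (auto intro: powr_mono2)
    also have "\<dots> \<le> B \<omega>"
      unfolding B_def using r_gt_1 A_nonneg[of \<omega>] R(1) by (intro powr_times_le) auto
    finally show ?case by simp
  qed
  have X_lim: "AE \<omega> in M. (\<lambda>n. X n \<omega>) \<longlonglongrightarrow> XF \<omega>"
    using grad_tendsto_F AE_space
  proof eventually_elim
    case (elim \<omega>)
    have lim: "(\<lambda>n. grad (z n) \<omega> e) \<longlonglongrightarrow> F \<omega> e" if "e \<in> U" for e
    proof -
      have "(\<lambda>n. grad (y n) \<omega> e + t n * grad g \<omega> e) \<longlonglongrightarrow> F \<omega> e + 0 * grad g \<omega> e"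
        using elim that by (intro tendsto_intros t_lim) auto
      then show ?thesis by (simp add: grad_z)
    qed
    have "(\<lambda>n. excess (grad (z n)) \<omega>) \<longlonglongrightarrow> excess F \<omega>"
      unfolding excess_def using elim lim by (intro tendsto_intros tendsto_Phi) auto
    \<comment> \<open>The limit of the base may be zero; the exponent \<open>r - 1\<close> is
      positive, so the power still converges.\<close>
    then have "(\<lambda>n. excess (grad (z n)) \<omega> powr (r - 1)) \<longlonglongrightarrow> weight \<omega>"
      unfolding weight_def using r_gt_1 excess_nonneg by (intro tendsto_powr' tendsto_const) auto
    then show ?case
      unfolding X_def XF_def using elim lim by (intro tendsto_intros tendsto_tilt) auto
  qed
  have lim: "(\<lambda>n. \<integral>\<omega>. X n \<omega> \<partial>M) \<longlonglongrightarrow> (\<integral>\<omega>. XF \<omega> \<partial>M)"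
    using XF_meas X_meas B_int X_lim X_le by (rule integral_dominated_convergence)
  have X_int: "integrable M (X n)" for n
    by (rule Bochner_Integration.integrable_bound[OF B_int X_meas]) (use X_le[of n] in \<open>eventually_elim, auto\<close>)
  have "- t n / r \<le> (\<integral>\<omega>. X n \<omega> \<partial>M)" for n
  proof -
    have "inf_cost - (inf_cost + (t n)\<^sup>2) \<le> cost (z n) - cost (y n)"
      using inf_cost_le[OF zb] y_cost[of n] unfolding t_def by (rule diff_mono)
    also have "\<dots> \<le> r * t n * (\<integral>\<omega>. X n \<omega> \<partial>M)"
      using y_bounded g less_imp_le[OF t(1)] z_def X_def X_int by (rule cost_increment_le)
    finally have "t n * (- t n) \<le> t n * (r * (\<integral>\<omega>. X n \<omega> \<partial>M))"
      by (simp add: power2_eq_square mult_ac)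
    then have "- t n \<le> r * (\<integral>\<omega>. X n \<omega> \<partial>M)"
      using t(1)[of n] by (rule mult_left_le_imp_le)
    then show ?thesis using r_gt_1 by (simp add: field_simps)
  qed
  moreover have "(\<lambda>n. - t n / r) \<longlonglongrightarrow> - 0 / r"
    using r_gt_1 by (intro tendsto_intros t_lim) auto
  ultimately show ?thesis
    using LIMSEQ_le[OF _ lim, of "\<lambda>n. - t n / r" "- 0 / r"] unfolding XF_def by auto
qed

text \<open>The one-sided condition applied to both \<open>g\<close> and \<open>- g\<close>.\<close>

lemma stationary:
  assumes g: "bounded_measurable M g"
  shows "(\<integral>\<omega>. weight \<omega> * (\<Sum>e\<in>U. tilt F \<omega> e * grad g \<omega> e) \<partial>M) = 0"
proof -
  have "bounded_measurable M (\<lambda>\<omega>. - g \<omega>)"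
    using g by (auto simp: bounded_measurable_def)
  moreover have "grad (\<lambda>\<omega>. - g \<omega>) \<omega> e = - grad g \<omega> e" for \<omega> e by (simp add: grad_def)
  ultimately have "0 \<le> - (\<integral>\<omega>. weight \<omega> * (\<Sum>e\<in>U. tilt F \<omega> e * grad g \<omega> e) \<partial>M)"
    using stationary_ge[of "\<lambda>\<omega>. - g \<omega>"] by (simp add: sum_negf)
  then show ?thesis using stationary_ge[OF g] by argo
qed

text \<open>Stationarity tests only gradients of bounded functions. Dominated convergence along
  \<open>grad (y n)\<close> extends it to their limit \<open>F\<close>.\<close>

lemma weight_tilt_F:
  shows "(\<integral>\<omega>. weight \<omega> * (\<Sum>e\<in>U. tilt F \<omega> e * F \<omega> e) \<partial>M) = 0"
    and "integrable M (\<lambda>\<omega>. weight \<omega> * (\<Sum>e\<in>U. tilt F \<omega> e * F \<omega> e))"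
proof -
  define B where "B \<omega> = A \<omega> powr r + grad_dom A \<omega> powr r" for \<omega>
  have nn: "0 \<le> grad_dom A \<omega>" for \<omega> using A_nonneg by (rule grad_dom_nonneg)
  have B_int: "integrable M B"
    unfolding B_def[abs_def] using A_Lr Lr_grad_dom[OF A_Lr] A_nonneg nn
    by (auto simp: Lr_def)
  have le: "\<bar>weight \<omega> * (\<Sum>e\<in>U. tilt F \<omega> e * v e)\<bar> \<le> B \<omega>"
    if "\<omega> \<in> space M" "excess F \<omega> \<le> A \<omega>" "\<And>e. e \<in> U \<Longrightarrow> \<bar>v e\<bar> \<le> grad_dom A \<omega>" for v \<omega>
  proof -
    have "\<bar>weight \<omega> * (\<Sum>e\<in>U. tilt F \<omega> e * v e)\<bar> \<le> A \<omega> powr (r - 1) * grad_dom A \<omega>"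
      unfolding abs_mult weight_def using that r_gt_1 excess_nonneg
      by (intro mult_mono abs_tilt_sum_le) (auto intro: powr_mono2)
    also have "\<dots> \<le> B \<omega>"
      unfolding B_def using r_gt_1 A_nonneg nn by (intro powr_times_le)
    finally show ?thesis .
  qed
  let ?X = "\<lambda>v \<omega>. weight \<omega> * (\<Sum>e\<in>U. tilt F \<omega> e * v \<omega> e)"
  have "(\<lambda>n. \<integral>\<omega>. ?X (grad (y n)) \<omega> \<partial>M) \<longlonglongrightarrow> (\<integral>\<omega>. ?X F \<omega> \<partial>M)"
  proof (rule integral_dominated_convergence[where w = B])
    show "?X F \<in> borel_measurable M" by measurable
    show "?X (grad (y n)) \<in> borel_measurable M" for n by measurable
    show "AE \<omega> in M. (\<lambda>n. ?X (grad (y n)) \<omega>) \<longlonglongrightarrow> ?X F \<omega>"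
      using grad_tendsto_F by eventually_elim (intro tendsto_intros, auto)
    show "AE \<omega> in M. norm (?X (grad (y n)) \<omega>) \<le> B \<omega>" for n
      using excess_F_le grad_y_dominated AE_space
      by eventually_elim (simp only: real_norm_def, intro le, auto)
  qed (rule B_int)
  moreover have "(\<integral>\<omega>. ?X (grad (y n)) \<omega> \<partial>M) = 0" for n
    using y_bounded by (rule stationary)
  ultimately show "(\<integral>\<omega>. ?X F \<omega> \<partial>M) = 0"
    by (simp add: LIMSEQ_const_iff)
  show "integrable M (?X F)"
  proof (rule Bochner_Integration.integrable_bound[OF B_int])
    show "?X F \<in> borel_measurable M" by measurable
    show "AE \<omega> in M. norm (?X F \<omega>) \<le> norm (B \<omega>)"
      using excess_F_le F_dominated AE_space
    proof eventually_elim
      case (elim \<omega>)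
      then have "\<bar>?X F \<omega>\<bar> \<le> B \<omega>" by (intro le) auto
      then show ?case by simp
    qed
  qed
qed

section \<open>The limiting kernel and density as a competitor in \<open>Gamma\<close>\<close>

lemma excess_F_powr_integrable: "integrable M (\<lambda>\<omega>. excess F \<omega> powr r)"
proof (rule Bochner_Integration.integrable_bound)
  show "integrable M (\<lambda>\<omega>. \<bar>A \<omega>\<bar> powr r)" using A_Lr by (simp add: Lr_def)
  show "AE \<omega> in M. norm (excess F \<omega> powr r) \<le> norm (\<bar>A \<omega>\<bar> powr r)"
    using excess_F_le by eventually_elim (use r_gt_1 excess_nonneg in \<open>auto intro!: powr_mono2\<close>)
qed measurable

lemma weight_integrable: "integrable M weight"
proof (rule Bochner_Integration.integrable_bound)
  show "integrable M (\<lambda>\<omega>. excess F \<omega> powr r + 1 powr r)"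
    using excess_F_powr_integrable by simp
  have "weight \<omega> \<le> excess F \<omega> powr r + 1 powr r" for \<omega>
    using powr_times_le[of r "excess F \<omega>" 1] r_gt_1 excess_nonneg by (simp add: weight_def)
  then show "AE \<omega> in M. norm (weight \<omega>) \<le> norm (excess F \<omega> powr r + 1 powr r)"
    by (simp add: weight_def)
qed measurable

text \<open>For the tilted kernel the drift minus the entropy is \<open>Phi F\<close> minus the mean
  of \<open>F\<close>. The mean of \<open>F\<close> integrates to zero against
  \<open>weight\<close>, and \<open>weight\<close> lives where \<open>Phi F > c\<close>.\<close>

lemma Gamma_ge_level:
  assumes pos: "0 < (\<integral>\<omega>. weight \<omega> \<partial>M)"
  shows "ereal c \<le> Gamma M T p l"
proof -
  define m where "m = (\<integral>\<omega>. weight \<omega> \<partial>M)"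
  have m: "0 < m" using pos by (simp add: m_def)
  define \<phi> where "\<phi> \<omega> = weight \<omega> / m" for \<omega>
  have [measurable]: "\<phi> \<in> borel_measurable M" unfolding \<phi>_def[abs_def] by measurable
  define G where "G = (\<lambda>\<omega>. (\<Sum>e\<in>U. ip l e * tilt F \<omega> e -
    (if tilt F \<omega> e = 0 then 0 else tilt F \<omega> e * ln (tilt F \<omega> e / p \<omega> e))) * \<phi> \<omega>)"
  \<comment> \<open>The same function as \<open>G\<close> almost everywhere, split into terms
    already known to be integrable. It uses
    \<open>weight * Phi F = c * weight + excess F powr r\<close>, where both sides vanish if the
    excess does.\<close>
  define G' where "G' \<omega> = (c * weight \<omega> + excess F \<omega> powr r
    - weight \<omega> * (\<Sum>e\<in>U. tilt F \<omega> e * F \<omega> e)) / m" for \<omega>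
  have G'_int: "integrable M G'"
    unfolding G'_def[abs_def] using weight_integrable excess_F_powr_integrable weight_tilt_F(2) by simp
  have G_meas: "G \<in> borel_measurable M" unfolding G_def by measurable
  have eq: "AE \<omega> in M. G' \<omega> = G \<omega>"
    using AE_p_pos AE_space
  proof eventually_elim
    case (elim \<omega>)
    have tl: "tilt F \<omega> e = p \<omega> e * exp (ip l e + F \<omega> e - Phi F \<omega>)" for e
      unfolding tilt_def Phi_def using prob_weights.gibbs_eq[OF weights[OF elim(2)]] by simp
    have "(\<Sum>e\<in>U. ip l e * tilt F \<omega> e -
        (if tilt F \<omega> e = 0 then 0 else tilt F \<omega> e * ln (tilt F \<omega> e / p \<omega> e)))
      = (\<Sum>e\<in>U. tilt F \<omega> e * Phi F \<omega> - tilt F \<omega> e * F \<omega> e)"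
    proof (rule sum.cong[OF refl])
      fix e assume e: "e \<in> U"
      then have pe: "0 < p \<omega> e" using elim by blast
      then have t0: "tilt F \<omega> e \<noteq> 0" and ln_eq: "ln (tilt F \<omega> e / p \<omega> e) = ip l e + F \<omega> e - Phi F \<omega>"
        unfolding tl by auto
      then show "ip l e * tilt F \<omega> e - (if tilt F \<omega> e = 0 then 0 else tilt F \<omega> e * ln (tilt F \<omega> e / p \<omega> e))
        = tilt F \<omega> e * Phi F \<omega> - tilt F \<omega> e * F \<omega> e"
        using t0 unfolding ln_eq by (simp add: algebra_simps)
    qed
    also have "\<dots> = Phi F \<omega> - (\<Sum>e\<in>U. tilt F \<omega> e * F \<omega> e)"
      unfolding tilt_def sum_subtractf sum_distrib_right[symmetric]
      using prob_weights.sum_gibbs[OF weights[OF elim(2)]] by simp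
    finally have "G \<omega> = (Phi F \<omega> - (\<Sum>e\<in>U. tilt F \<omega> e * F \<omega> e)) * \<phi> \<omega>"
      unfolding G_def by (rule arg_cong[where f = "\<lambda>s. s * \<phi> \<omega>"])
    then have "G \<omega> = (weight \<omega> * Phi F \<omega> - weight \<omega> * (\<Sum>e\<in>U. tilt F \<omega> e * F \<omega> e)) / m"
      by (simp add: \<phi>_def algebra_simps diff_divide_distrib)
    moreover have "weight \<omega> * Phi F \<omega> = c * weight \<omega> + excess F \<omega> powr r"
    proof (cases "excess F \<omega> = 0")
      case False
      then have "Phi F \<omega> = c + excess F \<omega>" by (auto simp: excess_def max_def split: if_splits)
      moreover have "weight \<omega> * excess F \<omega> = excess F \<omega> powr r"
        using False excess_nonneg[of F \<omega>] by (simp add: weight_def powr_diff)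
      ultimately show ?thesis by (simp add: algebra_simps)
    qed (simp add: weight_def)
    ultimately show ?case by (simp add: G'_def)
  qed
  have G_int: "integrable M G" using G'_int G_meas eq by (rule integrable_cong_AE_imp)
  have "ereal (\<integral>\<omega>. G \<omega> \<partial>M) \<le> Gamma M T p l"
  proof (rule Gamma_ge[OF _ _ G_def G_int])
    show "transition_fn M (tilt F)" by (rule transition_tilt) measurable
    have "(\<integral>\<^sup>+\<omega>. ennreal (\<phi> \<omega>) \<partial>M) = ennreal (\<integral>\<omega>. \<phi> \<omega> \<partial>M)"
      using weight_integrable m unfolding \<phi>_def
      by (intro nn_integral_eq_integral) (auto simp: weight_nonneg)
    also have "(\<integral>\<omega>. \<phi> \<omega> \<partial>M) = 1" unfolding \<phi>_def using m by (simp add: m_def)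
    finally show "prob_density M \<phi>"
      using m by (simp add: prob_density_def \<phi>_def weight_nonneg)
    fix h assume h: "bounded_measurable M h"
    have "(\<integral>\<omega>. (\<Sum>e\<in>U. tilt F \<omega> e * grad h \<omega> e) * \<phi> \<omega> \<partial>M)
      = (\<integral>\<omega>. weight \<omega> * (\<Sum>e\<in>U. tilt F \<omega> e * grad h \<omega> e) / m \<partial>M)"
      by (simp add: \<phi>_def mult.commute)
    then show "(\<integral>\<omega>. (\<Sum>e\<in>U. tilt F \<omega> e * grad h \<omega> e) * \<phi> \<omega> \<partial>M) = 0"
      using stationary[OF h] by simp
  qed
  moreover have "(\<integral>\<omega>. G \<omega> \<partial>M) = (\<integral>\<omega>. G' \<omega> \<partial>M)"
    using G_meas G'_int eq by (intro integral_cong_AE) auto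
  moreover have "(\<integral>\<omega>. G' \<omega> \<partial>M) = (c * m + (\<integral>\<omega>. excess F \<omega> powr r \<partial>M)) / m"
    unfolding G'_def using weight_integrable excess_F_powr_integrable weight_tilt_F by (simp add: m_def)
  moreover have "c \<le> (c * m + (\<integral>\<omega>. excess F \<omega> powr r \<partial>M)) / m"
    using m by (simp add: pos_le_divide_eq Bochner_Integration.integral_nonneg)
  ultimately show ?thesis by (metis ereal_less_eq(3) order_trans)
qed

text \<open>A level strictly above \<open>Gamma\<close> forces the nonnegative \<open>weight\<close>
  to have integral zero, hence the excess of \<open>F\<close> to vanish almost everywhere.\<close>

lemma Phi_F_le:
  assumes "Gamma M T p l < ereal c"
  shows "AE \<omega> in M. Phi F \<omega> \<le> c"
proof -
  have "\<not> 0 < (\<integral>\<omega>. weight \<omega> \<partial>M)" using Gamma_ge_level assms by (auto simp: not_le[symmetric])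
  moreover have "0 \<le> (\<integral>\<omega>. weight \<omega> \<partial>M)"
    by (rule Bochner_Integration.integral_nonneg) (rule weight_nonneg)
  ultimately have "(\<integral>\<omega>. weight \<omega> \<partial>M) = 0" by argo
  moreover have "AE \<omega> in M. 0 \<le> weight \<omega>" by (simp add: weight_nonneg)
  ultimately have "AE \<omega> in M. weight \<omega> = 0"
    using integral_nonneg_eq_0_iff_AE[OF weight_integrable] by blast
  then show ?thesis
    by eventually_elim (auto simp: weight_def excess_def max_def split: if_splits)
qed

section \<open>Membership in class K and conclusion\<close>

text \<open>Moments come from the majorant \<open>grad_dom A\<close>. The mean-zero and loop
  conditions hold for each \<open>grad (y n)\<close> and pass to the limit, the former by dominated
  convergence.\<close>

lemma classK_F:
  assumes "r = real CARD('n) + \<alpha>" "0 < \<alpha>"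
  shows "classK M T F"
  unfolding classK_def
proof (intro conjI exI[of _ \<alpha>] ballI assms(2))
  have dom: "Lr M r (grad_dom A)" using A_Lr by (rule Lr_grad_dom)
  have dom_int: "integrable M (grad_dom A)" using dom r_gt_1 by (intro Lr_integrable[OF dom]) auto
  fix e assume e: "e \<in> U"
  have "AE \<omega> in M. \<bar>F \<omega> e\<bar> \<le> \<bar>grad_dom A \<omega>\<bar>"
    using F_dominated by eventually_elim (use e in force)
  then have Fe: "Lr M r (\<lambda>\<omega>. F \<omega> e)"
    using r_gt_1 by (intro Lr_mono[OF dom]) auto
  then show "integrable M (\<lambda>\<omega>. \<bar>F \<omega> e\<bar> powr (real CARD('n) + \<alpha>))"
    using assms(1) by (simp add: Lr_def)
  show "integrable M (\<lambda>\<omega>. F \<omega> e)" using Fe r_gt_1 by (intro Lr_integrable) auto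
  have "(\<lambda>n. \<integral>\<omega>. grad (y n) \<omega> e \<partial>M) \<longlonglongrightarrow> (\<integral>\<omega>. F \<omega> e \<partial>M)"
  proof (rule integral_dominated_convergence[OF _ _ dom_int])
    show "AE \<omega> in M. (\<lambda>n. grad (y n) \<omega> e) \<longlonglongrightarrow> F \<omega> e"
      using grad_tendsto_F by eventually_elim (use e in auto)
    show "AE \<omega> in M. norm (grad (y n) \<omega> e) \<le> grad_dom A \<omega>" for n
      using grad_y_dominated by eventually_elim (use e in auto)
  qed measurable
  then show "(\<integral>\<omega>. F \<omega> e \<partial>M) = 0"
    by (simp add: integral_grad(2)[OF y_bounded] LIMSEQ_const_iff)
next
  \<comment> \<open>The loop condition involves whole orbits. The lattice is countable and each
    \<open>T x\<close> preserves null sets, so one null set serves all \<open>x\<close> and hence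
    all paths.\<close>
  have "AE \<omega> in M. \<forall>x. \<forall>e\<in>U. (\<lambda>n. grad (y n) (T x \<omega>) e) \<longlonglongrightarrow> F (T x \<omega>) e"
    unfolding AE_all_countable using AE_T[OF grad_tendsto_F] by blast
  then show "AE \<omega> in M. \<forall>xs. nn_path xs \<and> hd xs = last xs \<longrightarrow>
    (\<Sum>i<length xs - 1. F (T (xs ! i) \<omega>) (xs ! Suc i - xs ! i)) = 0"
    using AE_space
  proof eventually_elim
    case (elim \<omega>)
    show ?case
    proof (intro allI impI)
      fix xs :: "(int ^ 'n) list" assume xs: "nn_path xs \<and> hd xs = last xs"
      have "(\<lambda>n. \<Sum>i<length xs - 1. grad (y n) (T (xs ! i) \<omega>) (xs ! Suc i - xs ! i))
        \<longlonglongrightarrow> (\<Sum>i<length xs - 1. F (T (xs ! i) \<omega>) (xs ! Suc i - xs ! i))"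
        using elim xs by (intro tendsto_sum) (auto simp: nn_path_def)
      then show "(\<Sum>i<length xs - 1. F (T (xs ! i) \<omega>) (xs ! Suc i - xs ! i)) = 0"
        unfolding loop_sum_grad[OF elim(2) conjunct2[OF xs]] by (simp only: LIMSEQ_const_iff)
    qed
  qed
qed

end

text \<open>Measurability of \<open>F\<close> is exported along with membership in class K because
  \<open>esssup_I\<close> asks for it.\<close>

lemma (in random_environment) classK_below_level:
  assumes "Gamma M T p l < ereal c" "r = real CARD('n) + \<alpha>" "0 < \<alpha>"
  obtains F where "classK M T F" "\<And>e. (\<lambda>\<omega>. F \<omega> e) \<in> borel_measurable M" "AE \<omega> in M. Phi F \<omega> \<le> c"
proof -
  interpret excess_problem M T p l r c by unfold_locales
  show ?thesis
  proof (rule convergent_near_minimizers)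
    fix A y
    assume "Lr M r A" "\<And>\<omega>. 0 \<le> A \<omega>" "\<And>n. bounded_measurable M (y n)"
      "\<And>n. cost (y n) \<le> inf_cost + (1 / real (Suc n))\<^sup>2"
      "\<And>n. AE \<omega> in M. excess (grad (y n)) \<omega> \<le> A \<omega>"
      "AE \<omega> in M. \<forall>e\<in>U. convergent (\<lambda>n. grad (y n) \<omega> e)"
    then interpret minimizing_sequence M T p l r c A y
      by unfold_locales
    show ?thesis
      using classK_F[OF assms(2,3)] F_measurable Phi_F_le[OF assms(1)] by (rule that)
  qed
qed

theorem theorem3p4:
  fixes M :: "'a measure"
    and T :: "int ^ 'n::finite \<Rightarrow> 'a \<Rightarrow> 'a"
    and p :: "'a \<Rightarrow> int ^ 'n \<Rightarrow> real"
    and l :: "real ^ 'n"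
    and \<alpha> \<epsilon> :: real
  assumes "prob_space M"
    and "countably_generated M"
    and "Zd_action M T"
    and "ergodic_family M T"
    and "transition_fn M p"
    and "\<alpha> > 0"
    and "\<forall>e\<in>unitvecs. (AE \<omega> in M. p \<omega> e > 0) \<and>
           integrable M (\<lambda>\<omega>. \<bar>ln (p \<omega> e)\<bar> powr (real CARD('n) + \<alpha>))"
    and "\<epsilon> > 0"
  shows "\<exists>F. classK M T F \<and>
           esssup M (\<lambda>\<omega>. ereal (ln (\<Sum>e\<in>unitvecs. p \<omega> e * exp (ip l e + F \<omega> e))))
             \<le> Gamma M T p l + ereal \<epsilon>"
proof -
  define r where "r = real CARD('n) + \<alpha>"
  \<comment> \<open>The dimension is at least 1 and \<open>\<alpha>\<close> is positive, so the
    exponent exceeds 1, as strict convexity requires.\<close>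
  have "1 \<le> CARD('n)" using zero_less_card_finite[where 'a = 'n] by simp
  then have r: "1 < r" using \<open>\<alpha> > 0\<close> unfolding r_def by linarith
  have [measurable]: "(\<lambda>\<omega>. p \<omega> e) \<in> borel_measurable M" if "e \<in> unitvecs" for e
    using assms(5) that by (simp add: transition_fn_def)
  interpret prob_space M by fact
  interpret random_environment M T p l r
  proof unfold_locales
    show "Lr M r (\<lambda>\<omega>. ln (p \<omega> e))" if "e \<in> unitvecs" for e
      using assms(7) that unfolding Lr_def r_def by auto
  qed (use assms r in auto)
  show ?thesis
  proof (cases "Gamma M T p l = \<infinity>")
    \<comment> \<open>With an infinite right side any member of class K will do; the zero function
      is one.\<close>
    case True
    have "classK M T (\<lambda>_ _. 0)"
      using \<open>\<alpha> > 0\<close> by (auto simp: classK_def)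
    then show ?thesis using True by (intro exI[of _ "\<lambda>_ _. 0"]) simp
  next
    case False
    then obtain \<gamma> where \<gamma>: "Gamma M T p l = ereal \<gamma>"
      using Gamma_neq_minf by (cases "Gamma M T p l") auto
    then have "Gamma M T p l < ereal (\<gamma> + \<epsilon>)" using \<open>\<epsilon> > 0\<close> by simp
    then obtain F where F: "classK M T F" "\<And>e. (\<lambda>\<omega>. F \<omega> e) \<in> borel_measurable M"
      "AE \<omega> in M. Phi F \<omega> \<le> \<gamma> + \<epsilon>"
      using classK_below_level[OF _ r_def \<open>\<alpha> > 0\<close>] by blast
    have "(\<lambda>\<omega>. ereal (Phi F \<omega>)) \<in> borel_measurable M"
      using Phi_measurable F(2) by simp
    moreover have "AE \<omega> in M. ereal (Phi F \<omega>) \<le> ereal (\<gamma> + \<epsilon>)"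
      using F(3) by simp
    ultimately have "esssup M (\<lambda>\<omega>. ereal (Phi F \<omega>)) \<le> ereal (\<gamma> + \<epsilon>)"
      by (rule esssup_I)
    then show ?thesis
      using F(1) unfolding Phi_def lse_def \<gamma> by (intro exI[of _ F]) simp
  qed
qed

end
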